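(* Let $N\in\mathbb{N}$ and let $w\in\mathcal{A}_N^{\mathbb{N}}$ be a periodic infinite word, and let $l\in\mathbb{N}$ be the length of its minimal period. Then for $\mathbf{x}_p\in\mathbf{P}^1(\mathbb{Q}_p)$, the pair $(w,\mathbf{x}_p)$ belongs to $\mathbf{LMad}$ if and only if $\mathbf{x}_p$ coincides with one of the eigenvectors of the matrix $A_{w_l}^T$ (the transpose of $A_{w_l}$).
   Context: Fix a prime $p$; $|\cdot|_p$ is the $p$-adic absolute value on $\mathbb{Q}_p$ (extended to $\overline{\mathbb{Q}}_p$). For $N\in\mathbb{N}$ let $\mathcal{A}_N=\{1,\dots,N\}$. For an infinite word $w=a_1a_2a_3\ldots$ over the positive integers, $\mathrm{T}$ is the left shift $\mathrm{T}w=a_2a_3\ldots$, and $w_l=a_1\ldots a_l$ denotes the prefix of length $l$. For $a\in\mathbb{N}$ put $A_a=\begin{pmatrix}0&1\\1&a\end{pmatrix}$ and for a finite word $u=a_1\ldots a_n$ put $A_u=A_{a_1}\cdots A_{a_n}$ (the identity for the empty word). Points of $\mathbf{P}^1(\mathbb{Q}_p)$ are written as column vectors $\mathbf{q}=(q_1,q_2)^T$ in homogeneous coordinates, and $\mathrm{T}$ is extended to pairs by $\mathrm{T}(w,\mathbf{q})=(\mathrm{T}w, A_{a_1}\mathbf{q})$. For $\epsilon>0$, a point $\mathbf{q}=(q_1,q_2)\in\mathbf{P}^1(\mathbb{Q}_p)$ is in $\mathbf{PBad}_\epsilon$ if for every $(a,b)\in\mathbb{Z}^2\setminus\{(0,0)\}$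 one has $\frac{|aq_1+bq_2|_p}{\max\{|q_1|_p,|q_2|_p\}}\ge \frac{\epsilon}{\max\{a^2,b^2\}}$. The set $\mathbf{LMad}_\epsilon$ consists of the pairs $(w,\mathbf{x}_p)$ ($w$ an infinite word over positive integers, $\mathbf{x}_p\in\mathbf{P}^1(\mathbb{Q}_p)$) such that for every integer $n\ge 0$, $\mathrm{T}^n(w,\mathbf{x}_p)\in\mathcal{A}_N^{\mathbb{N}}\times\mathbf{PBad}_\epsilon$ where $N=\lfloor\epsilon^{-1}\rfloor+1$; and $\mathbf{LMad}=\bigcup_{\epsilon>0}\mathbf{LMad}_\epsilon$. *)

theory Defs
  imports
    "HOL-Analysis.Analysis"
    "HOL-Library.Stream"
    "Berlekamp_Zassenhaus.Finite_Field"
begin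

section \<open>The field of p-adic numbers\<close>

definition rat_padic_abs :: "nat \<Rightarrow> rat \<Rightarrow> real" where
  "rat_padic_abs p x =
    (if x = 0 then 0
     else real p powi (int (multiplicity (int p) (snd (quotient_of x)))
                       - int (multiplicity (int p) (fst (quotient_of x)))))"

definition padic_Cauchy :: "nat \<Rightarrow> (nat \<Rightarrow> rat) \<Rightarrow> bool" where
  "padic_Cauchy p X \<longleftrightarrow> (\<forall>e>0. \<exists>M. \<forall>m\<ge>M. \<forall>n\<ge>M. rat_padic_abs p (X m - X n) < e)"

definition padic_rel :: "nat \<Rightarrow> (nat \<Rightarrow> rat) \<Rightarrow> (nat \<Rightarrow> rat) \<Rightarrow> bool" where
  "padic_rel p X Y \<longleftrightarrow> padic_Cauchy p X \<and> padic_Cauchy p Y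
     \<and> (\<lambda>n. rat_padic_abs p (X n - Y n)) \<longlonglongrightarrow> 0"

lemma rat_padic_abs_0 [simp]: "rat_padic_abs p 0 = 0"
  by (simp add: rat_padic_abs_def)

lemma rat_padic_abs_fraction:
  fixes a b :: int
  assumes p: "prime p" and a: "a \<noteq> 0" and b: "b \<noteq> 0"
  shows "rat_padic_abs p (of_int a / of_int b)
     = real p powi (int (multiplicity (int p) b) - int (multiplicity (int p) a))"
proof -
  let ?x = "of_int a / of_int b :: rat"
  obtain c d where cd: "quotient_of ?x = (c, d)" by fastforce
  have d: "d > 0" using quotient_of_denom_pos[OF cd] .
  have x: "?x = of_int c / of_int d" using quotient_of_div[OF cd] .
  have x0: "?x \<noteq> 0" using a b by simp
  have c: "c \<noteq> 0" using x x0 by auto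
  have "(of_int (a * d) :: rat) = of_int (c * b)"
    using x b d by (simp add: field_simps)
  hence eq: "a * d = c * b" by (simp only: of_int_eq_iff)
  have pp: "prime_elem (int p)" using p by simp
  have "multiplicity (int p) a + multiplicity (int p) d = multiplicity (int p) (a * d)"
    using prime_elem_multiplicity_mult_distrib[OF pp a, of d] d by simp
  also have "\<dots> = multiplicity (int p) c + multiplicity (int p) b"
    using prime_elem_multiplicity_mult_distrib[OF pp c b] eq by simp
  finally have "int (multiplicity (int p) d) - int (multiplicity (int p) c)
      = int (multiplicity (int p) b) - int (multiplicity (int p) a)" by linarith
  thus ?thesis using x0 by (simp add: rat_padic_abs_def cd)
qed

lemma rat_as_fraction:
  obtains a b :: int where "(x :: rat) = of_int a / of_int b" "b > 0"
proof -
  obtain c d where cd: "quotient_of x = (c, d)" by fastforce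
  show ?thesis using that quotient_of_div[OF cd] quotient_of_denom_pos[OF cd] by blast
qed

lemma rat_padic_abs_nonneg [simp]: "rat_padic_abs p x \<ge> 0"
  by (simp add: rat_padic_abs_def)

lemma rat_padic_abs_eq_0_iff: "prime p \<Longrightarrow> rat_padic_abs p x = 0 \<longleftrightarrow> x = 0"
  by (auto simp: rat_padic_abs_def power_int_eq_0_iff dest: prime_gt_0_nat)

lemma rat_padic_abs_1 [simp]: "rat_padic_abs p 1 = 1"
  by (simp add: rat_padic_abs_def)

lemma rat_padic_abs_mult:
  assumes p: "prime p"
  shows "rat_padic_abs p (x * y) = rat_padic_abs p x * rat_padic_abs p y"
proof (cases "x = 0 \<or> y = 0")
  case False
  obtain a b where x: "x = of_int a / of_int b" and b: "b > 0" by (rule rat_as_fraction)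
  obtain c d where y: "y = of_int c / of_int d" and d: "d > 0" by (rule rat_as_fraction)
  have a: "a \<noteq> 0" and c: "c \<noteq> 0" using False x y by auto
  have xy: "x * y = of_int (a * c) / of_int (b * d)" by (simp add: x y)
  have pp: "prime_elem (int p)" using p by simp
  have p0: "real p \<noteq> 0" using prime_gt_0_nat[OF p] by simp
  have "rat_padic_abs p (x * y)
      = real p powi (int (multiplicity (int p) (b * d)) - int (multiplicity (int p) (a * c)))"
    unfolding xy using p a b c d by (intro rat_padic_abs_fraction) auto
  also have "\<dots> = real p powi ((int (multiplicity (int p) b) - int (multiplicity (int p) a))
                + (int (multiplicity (int p) d) - int (multiplicity (int p) c)))"
    using a b c d by (simp add: prime_elem_multiplicity_mult_distrib[OF pp] algebra_simps)
  also have "\<dots> = rat_padic_abs p x * rat_padic_abs p y"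
    unfolding x y using p a b c d p0 by (simp add: rat_padic_abs_fraction power_int_add)
  finally show ?thesis .
qed auto

lemma rat_padic_abs_minus:
  assumes "prime p"
  shows "rat_padic_abs p (- x) = rat_padic_abs p x"
proof -
  have "rat_padic_abs p (- 1) ^ 2 = 1"
    using rat_padic_abs_mult[OF assms, of "- 1" "- 1"] by (simp add: power2_eq_square)
  hence "rat_padic_abs p (- 1) = 1"
    using rat_padic_abs_nonneg[of p "- 1"] by (auto simp: power2_eq_1_iff)
  thus ?thesis using rat_padic_abs_mult[OF assms, of "- 1" x] by simp
qed

lemma rat_padic_abs_inverse:
  assumes "prime p" shows "rat_padic_abs p (inverse x) = inverse (rat_padic_abs p x)"
proof (cases "x = 0")
  case False
  have "rat_padic_abs p x * rat_padic_abs p (inverse x) = 1"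
    using False by (simp flip: rat_padic_abs_mult[OF assms])
  thus ?thesis by (metis inverse_unique)
qed auto

lemma rat_padic_abs_int_le_1:
  assumes p: "prime p" shows "rat_padic_abs p (of_int a) \<le> 1"
proof (cases "a = 0")
  case False
  have "rat_padic_abs p (of_int a) = real p powi (- int (multiplicity (int p) a))"
    using rat_padic_abs_fraction[OF p False, of 1] by simp
  also have "\<dots> \<le> 1" using prime_gt_0_nat[OF p]
    by (simp add: power_int_minus inverse_le_1_iff)
  finally show ?thesis .
qed auto

lemma rat_padic_abs_add:
  assumes p: "prime p"
  shows "rat_padic_abs p (x + y) \<le> max (rat_padic_abs p x) (rat_padic_abs p y)"
proof -
  have 1: "rat_padic_abs p (1 + z) \<le> 1" if z: "rat_padic_abs p z \<le> 1" for z
  proof (cases "z = 0")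
    case False
    obtain a b where q: "quotient_of z = (a, b)" by fastforce
    have zab: "z = of_int a / of_int b" and b: "b > 0" and co: "coprime a b"
      using quotient_of_div[OF q] quotient_of_denom_pos[OF q] quotient_of_coprime[OF q] by auto
    have a: "a \<noteq> 0" using False zab by auto
    have p1: "real p > 1" using prime_gt_1_nat[OF p] by simp
    have "multiplicity (int p) b = 0"
    proof (rule ccontr)
      assume nb: "multiplicity (int p) b \<noteq> 0"
      hence pb: "int p dvd b" by (metis not_dvd_imp_multiplicity_0)
      hence "\<not> int p dvd a" using co p
        by (metis coprime_common_divisor not_prime_unit prime_int_nat_transfer nat_int of_nat_0_le_iff)
      hence na: "multiplicity (int p) a = 0" by (rule not_dvd_imp_multiplicity_0)
      have "rat_padic_abs p z = real p ^ multiplicity (int p) b"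
        using rat_padic_abs_fraction[OF p a, of b] b zab na by simp
      also have "\<dots> > 1" using p1 nb by (simp add: one_less_power)
      finally show False using z by simp
    qed
    hence "rat_padic_abs p (of_int b) = 1"
      using rat_padic_abs_fraction[OF p, of b 1] b by simp
    moreover have "1 + z = of_int (a + b) * inverse (of_int b)"
      using b by (simp add: zab field_simps)
    ultimately have "rat_padic_abs p (1 + z) = rat_padic_abs p (of_int (a + b))"
      by (simp only: rat_padic_abs_mult[OF p] rat_padic_abs_inverse[OF p]) simp
    thus ?thesis using rat_padic_abs_int_le_1[OF p] by metis
  qed auto
  have 2: "rat_padic_abs p (x + y) \<le> rat_padic_abs p x"
    if le: "rat_padic_abs p y \<le> rat_padic_abs p x" for x y
  proof (cases "x = 0")
    case True
    thus ?thesis using le by simp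
  next
    case False
    hence pos: "rat_padic_abs p x > 0"
      using rat_padic_abs_eq_0_iff[OF p] rat_padic_abs_nonneg by (metis less_le)
    have "rat_padic_abs p (y / x) \<le> 1"
      using pos le by (simp add: divide_inverse rat_padic_abs_mult[OF p] rat_padic_abs_inverse[OF p])
         (simp add: field_simps)
    hence "rat_padic_abs p (1 + y / x) \<le> 1" by (rule 1)
    moreover have "x + y = x * (1 + y / x)" using False by (simp add: field_simps)
    ultimately show ?thesis using pos by (simp add: rat_padic_abs_mult[OF p] mult_left_le)
  qed
  show ?thesis
    using 2[of y x] 2[of x y] by (cases "rat_padic_abs p y \<le> rat_padic_abs p x") (auto simp: add.commute)
qed

lemma rat_padic_abs_triangle:
  assumes p: "prime p"
  shows "rat_padic_abs p (x + y) \<le> rat_padic_abs p x + rat_padic_abs p y"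
  using rat_padic_abs_add[OF p, of x y] rat_padic_abs_nonneg[of p x] rat_padic_abs_nonneg[of p y]
  by linarith

lemma rat_padic_abs_diff:
  assumes p: "prime p"
  shows "\<bar>rat_padic_abs p x - rat_padic_abs p y\<bar> \<le> rat_padic_abs p (x - y)"
  using rat_padic_abs_triangle[OF p, of "x - y" y] rat_padic_abs_triangle[OF p, of "y - x" x]
    rat_padic_abs_minus[OF p, of "x - y"] by simp

lemma padic_Cauchy_iff_tendsto:
  "padic_Cauchy p X \<longleftrightarrow>
     ((\<lambda>(m, n). rat_padic_abs p (X m - X n)) \<longlongrightarrow> 0) (sequentially \<times>\<^sub>F sequentially)"
proof -
  have "(\<forall>\<^sub>F (m, n) in sequentially \<times>\<^sub>F sequentially. P m n) \<longleftrightarrow> (\<exists>M. \<forall>m\<ge>M. \<forall>n\<ge>M. P m n)"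
    for P :: "nat \<Rightarrow> nat \<Rightarrow> bool"
    by (simp add: eventually_prod_sequentially) blast
  from this[of "\<lambda>m n. rat_padic_abs p (X m - X n) < e" for e] show ?thesis
    by (simp add: padic_Cauchy_def tendsto_iff dist_real_def case_prod_unfold)
qed

lemma padic_Cauchy_convergent:
  assumes p: "prime p" and X: "padic_Cauchy p X"
  shows "convergent (\<lambda>n. rat_padic_abs p (X n))"
proof -
  have "Cauchy (\<lambda>n. rat_padic_abs p (X n))"
    unfolding Cauchy_def dist_real_def
    using X rat_padic_abs_diff[OF p] unfolding padic_Cauchy_def by (meson le_less_trans)
  thus ?thesis by (rule Cauchy_convergent)
qed

lemma padic_Cauchy_bounded:
  assumes p: "prime p" and X: "padic_Cauchy p X"
  obtains B where "B > 0" "\<And>n. rat_padic_abs p (X n) \<le> B"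
proof -
  have "Bseq (\<lambda>n. rat_padic_abs p (X n))"
    using padic_Cauchy_convergent[OF assms] by (rule convergent_imp_Bseq)
  thus ?thesis using that by (auto simp: Bseq_def)
qed

lemma padic_Cauchy_const [simp]: "padic_Cauchy p (\<lambda>_. c)"
  by (simp add: padic_Cauchy_def)

lemma padic_Cauchy_add:
  assumes p: "prime p" and X: "padic_Cauchy p X" and Y: "padic_Cauchy p Y"
  shows "padic_Cauchy p (\<lambda>n. X n + Y n)"
  unfolding padic_Cauchy_iff_tendsto
proof (rule tendsto_sandwich[OF _ _ tendsto_const])
  let ?F = "sequentially \<times>\<^sub>F sequentially :: (nat \<times> nat) filter"
  show "((\<lambda>z. (case z of (m, n) \<Rightarrow> rat_padic_abs p (X m - X n))
             + (case z of (m, n) \<Rightarrow> rat_padic_abs p (Y m - Y n))) \<longlongrightarrow> 0) ?F"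
    using tendsto_add[OF X[unfolded padic_Cauchy_iff_tendsto] Y[unfolded padic_Cauchy_iff_tendsto]]
    by simp
  show "\<forall>\<^sub>F z in ?F. (case z of (m, n) \<Rightarrow> rat_padic_abs p (X m + Y m - (X n + Y n)))
      \<le> (case z of (m, n) \<Rightarrow> rat_padic_abs p (X m - X n))
             + (case z of (m, n) \<Rightarrow> rat_padic_abs p (Y m - Y n))"
    by (intro always_eventually)
       (auto simp: add_diff_add intro: rat_padic_abs_triangle[OF p])
qed (auto intro!: always_eventually)

lemma padic_Cauchy_minus:
  assumes p: "prime p" and X: "padic_Cauchy p X"
  shows "padic_Cauchy p (\<lambda>n. - X n)"
proof -
  have "rat_padic_abs p (- X m - - X n) = rat_padic_abs p (X m - X n)" for m n
    using rat_padic_abs_minus[OF p, of "X m - X n"] by simp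
  thus ?thesis using X unfolding padic_Cauchy_def by presburger
qed

lemma rat_padic_abs_mult_diff:
  assumes p: "prime p"
  shows "rat_padic_abs p (a * b - c * d)
    \<le> rat_padic_abs p (a - c) * rat_padic_abs p b + rat_padic_abs p c * rat_padic_abs p (b - d)"
proof -
  have "a * b - c * d = (a - c) * b + c * (b - d)" by (simp add: algebra_simps)
  thus ?thesis using rat_padic_abs_triangle[OF p] by (metis rat_padic_abs_mult[OF p])
qed

lemma padic_Cauchy_mult:
  assumes p: "prime p" and X: "padic_Cauchy p X" and Y: "padic_Cauchy p Y"
  shows "padic_Cauchy p (\<lambda>n. X n * Y n)"
proof -
  let ?F = "sequentially \<times>\<^sub>F sequentially :: (nat \<times> nat) filter"
  obtain B where B: "B > 0" "\<And>n. rat_padic_abs p (X n) \<le> B"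
    using padic_Cauchy_bounded[OF p X] by blast
  obtain C where C: "C > 0" "\<And>n. rat_padic_abs p (Y n) \<le> C"
    using padic_Cauchy_bounded[OF p Y] by blast
  show ?thesis
    unfolding padic_Cauchy_iff_tendsto
  proof (rule tendsto_sandwich[OF _ _ tendsto_const])
    show "((\<lambda>z. (case z of (m, n) \<Rightarrow> rat_padic_abs p (X m - X n)) * C
               + B * (case z of (m, n) \<Rightarrow> rat_padic_abs p (Y m - Y n))) \<longlongrightarrow> 0) ?F"
      using tendsto_add[OF tendsto_mult_left_zero[OF X[unfolded padic_Cauchy_iff_tendsto]]
         tendsto_mult_right_zero[OF Y[unfolded padic_Cauchy_iff_tendsto]]]
      by simp
    have "rat_padic_abs p (X m * Y m - X n * Y n)
        \<le> rat_padic_abs p (X m - X n) * C + B * rat_padic_abs p (Y m - Y n)" for m n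
      by (rule order_trans[OF rat_padic_abs_mult_diff[OF p]])
         (intro add_mono mult_left_mono mult_right_mono B C rat_padic_abs_nonneg)
    thus "\<forall>\<^sub>F z in ?F. (case z of (m, n) \<Rightarrow> rat_padic_abs p (X m * Y m - X n * Y n))
        \<le> (case z of (m, n) \<Rightarrow> rat_padic_abs p (X m - X n)) * C
               + B * (case z of (m, n) \<Rightarrow> rat_padic_abs p (Y m - Y n))"
      by (intro always_eventually) auto
  qed (auto intro!: always_eventually)
qed

lemma padic_not_null_bound:
  assumes p: "prime p" and X: "padic_Cauchy p X"
    and nz: "\<not> (\<lambda>n. rat_padic_abs p (X n)) \<longlonglongrightarrow> 0"
  obtains c where "c > 0" "\<forall>\<^sub>F n in sequentially. rat_padic_abs p (X n) > c"
proof -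
  obtain L where L: "(\<lambda>n. rat_padic_abs p (X n)) \<longlonglongrightarrow> L"
    using padic_Cauchy_convergent[OF p X] by (auto simp: convergent_def)
  have "L \<ge> 0" using L by (rule LIMSEQ_le_const) auto
  with nz L have "L > 0" by (cases "L = 0") auto
  hence "L / 2 < L" "L / 2 > 0" by auto
  thus ?thesis using that order_tendstoD(1)[OF L] by blast
qed

lemma rat_padic_abs_inverse_diff:
  assumes p: "prime p" and c: "c > 0"
    and x: "rat_padic_abs p x > c" and y: "rat_padic_abs p y > c"
  shows "rat_padic_abs p (inverse x - inverse y) \<le> rat_padic_abs p (x - y) * (inverse c * inverse c)"
proof -
  have nz: "x \<noteq> 0" "y \<noteq> 0" using c x y by auto
  have "inverse x - inverse y = - ((x - y) * (inverse x * inverse y))"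
    using nz by (simp add: field_simps)
  hence "rat_padic_abs p (inverse x - inverse y)
      = rat_padic_abs p (x - y) * (inverse (rat_padic_abs p x) * inverse (rat_padic_abs p y))"
    by (simp only: rat_padic_abs_minus[OF p] rat_padic_abs_mult[OF p] rat_padic_abs_inverse[OF p])
  also have "\<dots> \<le> rat_padic_abs p (x - y) * (inverse c * inverse c)"
    using c x y by (intro mult_left_mono mult_mono le_imp_inverse_le) auto
  finally show ?thesis .
qed

lemma padic_Cauchy_inverse:
  assumes p: "prime p" and X: "padic_Cauchy p X"
    and nz: "\<not> (\<lambda>n. rat_padic_abs p (X n)) \<longlonglongrightarrow> 0"
  shows "padic_Cauchy p (\<lambda>n. inverse (X n))"
proof -
  let ?F = "sequentially \<times>\<^sub>F sequentially :: (nat \<times> nat) filter"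
  obtain c where c: "c > 0" "\<forall>\<^sub>F n in sequentially. rat_padic_abs p (X n) > c"
    using padic_not_null_bound[OF assms] by blast
  show ?thesis
    unfolding padic_Cauchy_iff_tendsto
  proof (rule tendsto_sandwich[OF _ _ tendsto_const])
    show "((\<lambda>z. (case z of (m, n) \<Rightarrow> rat_padic_abs p (X m - X n)) * (inverse c * inverse c)) \<longlongrightarrow> 0) ?F"
      using tendsto_mult_left_zero[OF X[unfolded padic_Cauchy_iff_tendsto]] .
    show "\<forall>\<^sub>F z in ?F. (case z of (m, n) \<Rightarrow> rat_padic_abs p (inverse (X m) - inverse (X n)))
        \<le> (case z of (m, n) \<Rightarrow> rat_padic_abs p (X m - X n)) * (inverse c * inverse c)"
      using eventually_prodI[OF c(2) c(2)]
      by eventually_elim (auto intro!: rat_padic_abs_inverse_diff[OF p c(1)])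
  qed (auto intro!: always_eventually)
qed

lemma padic_rel_refl: "padic_Cauchy p X \<Longrightarrow> padic_rel p X X"
  by (simp add: padic_rel_def)

lemma padic_part_equivp: assumes p: "prime p" shows "part_equivp (padic_rel p)"
proof (rule part_equivpI)
  show "\<exists>X. padic_rel p X X" by (auto intro!: exI[of _ "\<lambda>_. 0"] simp: padic_rel_def)
  show "symp (padic_rel p)"
    unfolding padic_rel_def by (intro sympI) (metis (no_types, lifting) ext minus_diff_eq rat_padic_abs_minus[OF p])
  show "transp (padic_rel p)"
  proof (rule transpI)
    fix X Y Z assume XY: "padic_rel p X Y" and YZ: "padic_rel p Y Z"
    have "(\<lambda>n. rat_padic_abs p (X n - Z n)) \<longlonglongrightarrow> 0"
    proof (rule tendsto_sandwich[OF _ _ tendsto_const])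
      show "(\<lambda>n. rat_padic_abs p (X n - Y n) + rat_padic_abs p (Y n - Z n)) \<longlonglongrightarrow> 0"
        using XY YZ unfolding padic_rel_def by (auto intro!: tendsto_eq_intros)
      have "rat_padic_abs p (X n - Z n)
          \<le> rat_padic_abs p (X n - Y n) + rat_padic_abs p (Y n - Z n)" for n
        using rat_padic_abs_triangle[OF p, of "X n - Y n" "Y n - Z n"] by simp
      thus "\<forall>\<^sub>F n in sequentially. rat_padic_abs p (X n - Z n)
          \<le> rat_padic_abs p (X n - Y n) + rat_padic_abs p (Y n - Z n)" by simp
    qed auto
    thus "padic_rel p X Z" using XY YZ by (auto simp: padic_rel_def)
  qed
qed

lemma padic_relI:
  assumes p: "prime p" and "padic_Cauchy p X" "padic_Cauchy p Y" "g \<longlonglongrightarrow> 0"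
    and "\<forall>\<^sub>F n in sequentially. rat_padic_abs p (X n - Y n) \<le> g n"
  shows "padic_rel p X Y"
  unfolding padic_rel_def using assms
  by (auto intro: tendsto_sandwich[OF _ _ tendsto_const])

lemma padic_rel_add:
  assumes p: "prime p" and X: "padic_rel p X X'" and Y: "padic_rel p Y Y'"
  shows "padic_rel p (\<lambda>n. X n + Y n) (\<lambda>n. X' n + Y' n)"
proof (rule padic_relI[OF p])
  show "(\<lambda>n. rat_padic_abs p (X n - X' n) + rat_padic_abs p (Y n - Y' n)) \<longlonglongrightarrow> 0"
    using X Y unfolding padic_rel_def by (auto intro!: tendsto_eq_intros)
qed (use X Y in \<open>auto simp: padic_rel_def add_diff_add intro!: padic_Cauchy_add[OF p] always_eventually rat_padic_abs_triangle[OF p]\<close>)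

lemma padic_rel_minus:
  assumes p: "prime p" and X: "padic_rel p X X'"
  shows "padic_rel p (\<lambda>n. - X n) (\<lambda>n. - X' n)"
proof -
  have "rat_padic_abs p (- X n - - X' n) = rat_padic_abs p (X n - X' n)" for n
    using rat_padic_abs_minus[OF p, of "X n - X' n"] by simp
  thus ?thesis using X unfolding padic_rel_def by (auto intro: padic_Cauchy_minus[OF p])
qed

lemma padic_rel_mult:
  assumes p: "prime p" and X: "padic_rel p X X'" and Y: "padic_rel p Y Y'"
  shows "padic_rel p (\<lambda>n. X n * Y n) (\<lambda>n. X' n * Y' n)"
proof -
  have cX: "padic_Cauchy p X'" and cY: "padic_Cauchy p Y"
    using X Y by (auto simp: padic_rel_def)
  obtain B where B: "B > 0" "\<And>n. rat_padic_abs p (X' n) \<le> B"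
    using padic_Cauchy_bounded[OF p cX] by blast
  obtain C where C: "C > 0" "\<And>n. rat_padic_abs p (Y n) \<le> C"
    using padic_Cauchy_bounded[OF p cY] by blast
  show ?thesis
  proof (rule padic_relI[OF p])
    show "(\<lambda>n. rat_padic_abs p (X n - X' n) * C + B * rat_padic_abs p (Y n - Y' n)) \<longlonglongrightarrow> 0"
      using X Y unfolding padic_rel_def by (auto intro!: tendsto_eq_intros)
    have "rat_padic_abs p (X n * Y n - X' n * Y' n)
        \<le> rat_padic_abs p (X n - X' n) * C + B * rat_padic_abs p (Y n - Y' n)" for n
      by (rule order_trans[OF rat_padic_abs_mult_diff[OF p]])
         (intro add_mono mult_left_mono mult_right_mono B C rat_padic_abs_nonneg)
    thus "\<forall>\<^sub>F n in sequentially. rat_padic_abs p (X n * Y n - X' n * Y' n)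
        \<le> rat_padic_abs p (X n - X' n) * C + B * rat_padic_abs p (Y n - Y' n)" by simp
  qed (use X Y in \<open>auto simp: padic_rel_def intro!: padic_Cauchy_mult[OF p]\<close>)
qed

lemma padic_rel_abs_diff:
  assumes p: "prime p" and X: "padic_rel p X X'"
  shows "(\<lambda>n. rat_padic_abs p (X n) - rat_padic_abs p (X' n)) \<longlonglongrightarrow> 0"
proof (rule Lim_null_comparison)
  show "(\<lambda>n. rat_padic_abs p (X n - X' n)) \<longlonglongrightarrow> 0" using X by (simp add: padic_rel_def)
qed (use rat_padic_abs_diff[OF p] in auto)

lemma padic_rel_abs_tendsto_iff:
  assumes p: "prime p" and X: "padic_rel p X X'"
  shows "(\<lambda>n. rat_padic_abs p (X n)) \<longlonglongrightarrow> L \<longleftrightarrow> (\<lambda>n. rat_padic_abs p (X' n)) \<longlonglongrightarrow> L"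
  using tendsto_add[OF padic_rel_abs_diff[OF p X], of "\<lambda>n. rat_padic_abs p (X' n)" L]
    tendsto_diff[OF _ padic_rel_abs_diff[OF p X], of "\<lambda>n. rat_padic_abs p (X n)" L]
  by auto

lemma padic_rel_inverse:
  assumes p: "prime p" and X: "padic_rel p X X'"
    and nz: "\<not> (\<lambda>n. rat_padic_abs p (X n)) \<longlonglongrightarrow> 0"
  shows "padic_rel p (\<lambda>n. inverse (X n)) (\<lambda>n. inverse (X' n))"
proof -
  have nz': "\<not> (\<lambda>n. rat_padic_abs p (X' n)) \<longlonglongrightarrow> 0"
    using nz padic_rel_abs_tendsto_iff[OF p X] by simp
  have cX: "padic_Cauchy p X" and cX': "padic_Cauchy p X'" using X by (auto simp: padic_rel_def)
  obtain c where c: "c > 0" "\<forall>\<^sub>F n in sequentially. rat_padic_abs p (X n) > c"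
    using padic_not_null_bound[OF p cX nz] by blast
  obtain d where d: "d > 0" "\<forall>\<^sub>F n in sequentially. rat_padic_abs p (X' n) > d"
    using padic_not_null_bound[OF p cX' nz'] by blast
  let ?e = "min c d"
  show ?thesis
  proof (rule padic_relI[OF p])
    show "(\<lambda>n. rat_padic_abs p (X n - X' n) * (inverse ?e * inverse ?e)) \<longlonglongrightarrow> 0"
      using X unfolding padic_rel_def by (auto intro!: tendsto_mult_left_zero)
    show "\<forall>\<^sub>F n in sequentially. rat_padic_abs p (inverse (X n) - inverse (X' n))
        \<le> rat_padic_abs p (X n - X' n) * (inverse ?e * inverse ?e)"
      using c(2) d(2)
      by eventually_elim (rule rat_padic_abs_inverse_diff[OF p], use c d in auto)
  qed (use cX cX' nz nz' in \<open>auto intro!: padic_Cauchy_inverse[OF p]\<close>)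
qed

text \<open>The prime \<open>p\<close> is \<open>CARD('p)\<close>; the field \<open>\<rat>\<^sub>p\<close> consists of the \<open>p\<close>-adic Cauchy
  sequences of rationals modulo \<open>p\<close>-adic null sequences.\<close>

typedef ('p::prime_card) padic =
  "{X. padic_Cauchy CARD('p) X} // {(X, Y). padic_rel CARD('p) X Y}"
  morphisms Rep_padic Abs_padic
  by (auto intro!: exI quotientI[of "\<lambda>_. 0"])

definition abs_padic :: "(nat \<Rightarrow> rat) \<Rightarrow> 'p::prime_card padic" where
  "abs_padic X = Abs_padic (Collect (padic_rel CARD('p) X))"

definition rep_padic :: "'p::prime_card padic \<Rightarrow> nat \<Rightarrow> rat" where
  "rep_padic x = (SOME X. X \<in> Rep_padic x)"

definition cr_padic :: "(nat \<Rightarrow> rat) \<Rightarrow> 'p::prime_card padic \<Rightarrow> bool" where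
  "cr_padic = (\<lambda>X y. padic_rel CARD('p) X X \<and> abs_padic X = y)"

lemma padic_rel_refl_iff: "padic_rel p X X \<longleftrightarrow> padic_Cauchy p X"
  by (simp add: padic_rel_def)

lemma padic_quotient_eq:
  "{X. padic_Cauchy p X} // {(X, Y). padic_rel p X Y}
    = {C. \<exists>X. padic_rel p X X \<and> C = Collect (padic_rel p X)}"
  by (auto simp: quotient_def padic_rel_refl_iff Image_def)

lemma Quotient_padic:
  "Quotient (padic_rel CARD('p)) abs_padic rep_padic (cr_padic :: _ \<Rightarrow> 'p::prime_card padic \<Rightarrow> bool)"
proof -
  interpret quot_type "padic_rel CARD('p)" "Abs_padic :: _ \<Rightarrow> 'p padic" Rep_padic
  proof
    show "part_equivp (padic_rel CARD('p))" by (rule padic_part_equivp[OF prime_card])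
    show "\<exists>X. padic_rel CARD('p) X X \<and> Rep_padic y = Collect (padic_rel CARD('p) X)" for y :: "'p padic"
      using Rep_padic[of y] by (simp add: padic_quotient_eq)
    show "Rep_padic (Abs_padic C :: 'p padic) = C"
      if "\<exists>X. padic_rel CARD('p) X X \<and> C = Collect (padic_rel CARD('p) X)" for C
      by (rule Abs_padic_inverse) (use that in \<open>simp add: padic_quotient_eq\<close>)
  qed (auto simp: Rep_padic_inverse Rep_padic_inject)
  have "abs = abs_padic" "rep = rep_padic"
    by (auto simp: fun_eq_iff abs_def abs_padic_def rep_def rep_padic_def)
  hence "Quotient3 (padic_rel CARD('p)) abs_padic (rep_padic :: 'p padic \<Rightarrow> _)"
    using Quotient by simp
  thus ?thesis
    by (rule Quotient3_to_Quotient) (simp add: cr_padic_def)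
qed

setup_lifting Quotient_padic

instantiation padic :: (prime_card) field
begin

lift_definition zero_padic :: "'a padic" is "\<lambda>_. 0" by (simp add: padic_rel_refl)
lift_definition one_padic :: "'a padic" is "\<lambda>_. 1" by (simp add: padic_rel_refl)
lift_definition plus_padic :: "'a padic \<Rightarrow> 'a padic \<Rightarrow> 'a padic" is "\<lambda>X Y n. X n + Y n"
  by (rule padic_rel_add[OF prime_card])
lift_definition uminus_padic :: "'a padic \<Rightarrow> 'a padic" is "\<lambda>X n. - X n"
  by (rule padic_rel_minus[OF prime_card])
lift_definition times_padic :: "'a padic \<Rightarrow> 'a padic \<Rightarrow> 'a padic" is "\<lambda>X Y n. X n * Y n"
  by (rule padic_rel_mult[OF prime_card])
lift_definition inverse_padic :: "'a padic \<Rightarrow> 'a padic" is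
  "\<lambda>X. if (\<lambda>n. rat_padic_abs CARD('a) (X n)) \<longlonglongrightarrow> 0 then (\<lambda>_. 0) else (\<lambda>n. inverse (X n))"
  using padic_rel_abs_tendsto_iff[OF prime_card[where 'a='a], where L=0]
    padic_rel_inverse[OF prime_card[where 'a='a]]
  by (simp add: padic_rel_refl)

definition minus_padic :: "'a padic \<Rightarrow> 'a padic \<Rightarrow> 'a padic" where "minus_padic x y = x + - y"
definition divide_padic :: "'a padic \<Rightarrow> 'a padic \<Rightarrow> 'a padic" where "divide_padic x y = x * inverse y"

instance
proof
  fix a b c :: "'a padic"
  note prime = prime_card[where 'a='a]
  note cl = padic_rel_def padic_Cauchy_add[OF prime] padic_Cauchy_mult[OF prime] padic_Cauchy_minus[OF prime]
  show "a + b + c = a + (b + c)" by transfer (auto simp: cl algebra_simps)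
  show "a + b = b + a" by transfer (auto simp: cl algebra_simps)
  show "0 + a = a" by transfer (auto simp: cl)
  show "- a + a = 0" by transfer (auto simp: cl)
  show "a - b = a + - b" by (simp add: minus_padic_def)
  show "a * b * c = a * (b * c)" by transfer (auto simp: cl algebra_simps)
  show "a * b = b * a" by transfer (auto simp: cl algebra_simps)
  show "1 * a = a" by transfer (auto simp: cl)
  show "(a + b) * c = a * c + b * c" by transfer (auto simp: cl algebra_simps)
  show "(0 :: 'a padic) \<noteq> 1"
    by transfer (auto simp: padic_rel_def rat_padic_abs_minus[OF prime, of 1, simplified] LIMSEQ_const_iff)
  show "a div b = a * inverse b" by (simp add: divide_padic_def)
  show "inverse (0 :: 'a padic) = 0" by transfer (simp add: padic_rel_refl)
  show "inverse a * a = 1" if "a \<noteq> 0"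
    using that
  proof transfer
    fix X :: "nat \<Rightarrow> rat"
    assume X: "padic_rel CARD('a) X X" and "\<not> padic_rel CARD('a) X (\<lambda>_. 0)"
    hence nz: "\<not> (\<lambda>n. rat_padic_abs CARD('a) (X n)) \<longlonglongrightarrow> 0" and cX: "padic_Cauchy CARD('a) X"
      by (auto simp: padic_rel_def)
    obtain c where c: "c > 0" "\<forall>\<^sub>F n in sequentially. rat_padic_abs CARD('a) (X n) > c"
      using padic_not_null_bound[OF prime cX nz] by blast
    have "padic_rel CARD('a) (\<lambda>n. inverse (X n) * X n) (\<lambda>_. 1)"
    proof (rule padic_relI[OF prime _ _ tendsto_const])
      show "\<forall>\<^sub>F n in sequentially. rat_padic_abs CARD('a) (inverse (X n) * X n - 1) \<le> 0"
        using c(2) proof eventually_elim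
          case (elim n)
          hence "X n \<noteq> 0" using c(1) by auto
          thus ?case by simp
        qed
    qed (use cX nz in \<open>auto intro!: padic_Cauchy_mult[OF prime] padic_Cauchy_inverse[OF prime]\<close>)
    thus "padic_rel CARD('a)
       (\<lambda>n. (if (\<lambda>n. rat_padic_abs CARD('a) (X n)) \<longlonglongrightarrow> 0 then \<lambda>_. 0 else (\<lambda>n. inverse (X n))) n * X n)
       (\<lambda>_. 1)"
      using nz by simp
  qed
qed

end

lift_definition padic_abs :: "'p::prime_card padic \<Rightarrow> real" is
  "\<lambda>X. lim (\<lambda>n. rat_padic_abs CARD('p) (X n))"
proof -
  fix X Y assume "padic_rel CARD('p) X Y"
  from padic_rel_abs_tendsto_iff[OF prime_card this]
  show "lim (\<lambda>n. rat_padic_abs CARD('p) (X n)) = lim (\<lambda>n. rat_padic_abs CARD('p) (Y n))"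
    by (simp add: lim_def)
qed

lemma padic_Cauchy_abs_tendsto_lim:
  assumes "prime p" "padic_rel p X X"
  shows "(\<lambda>n. rat_padic_abs p (X n)) \<longlonglongrightarrow> lim (\<lambda>n. rat_padic_abs p (X n))"
  using assms padic_Cauchy_convergent convergent_LIMSEQ_iff unfolding padic_rel_def by blast

lemma padic_abs_mult: "padic_abs (x * y) = padic_abs x * padic_abs (y :: 'p::prime_card padic)"
proof transfer
  fix X Y :: "nat \<Rightarrow> rat"
  assume X: "padic_rel CARD('p) X X" and Y: "padic_rel CARD('p) Y Y"
  show "lim (\<lambda>n. rat_padic_abs CARD('p) (X n * Y n))
      = lim (\<lambda>n. rat_padic_abs CARD('p) (X n)) * lim (\<lambda>n. rat_padic_abs CARD('p) (Y n))"
    unfolding rat_padic_abs_mult[OF prime_card]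
    by (intro limI tendsto_mult padic_Cauchy_abs_tendsto_lim prime_card X Y)
qed

lemma padic_abs_nonneg: "padic_abs (x :: 'p::prime_card padic) \<ge> 0"
proof transfer
  fix X :: "nat \<Rightarrow> rat" assume "padic_rel CARD('p) X X"
  from padic_Cauchy_abs_tendsto_lim[OF prime_card this]
  show "0 \<le> lim (\<lambda>n. rat_padic_abs CARD('p) (X n))" by (rule LIMSEQ_le_const) auto
qed

lemma padic_abs_eq_0_iff: "padic_abs x = 0 \<longleftrightarrow> x = (0 :: 'p::prime_card padic)"
proof transfer
  fix X :: "nat \<Rightarrow> rat" assume X: "padic_rel CARD('p) X X"
  have "padic_rel CARD('p) X (\<lambda>_. 0) \<longleftrightarrow> (\<lambda>n. rat_padic_abs CARD('p) (X n)) \<longlonglongrightarrow> 0"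
    using X by (simp add: padic_rel_def)
  thus "lim (\<lambda>n. rat_padic_abs CARD('p) (X n)) = 0 \<longleftrightarrow> padic_rel CARD('p) X (\<lambda>_. 0)"
    using padic_Cauchy_abs_tendsto_lim[OF prime_card X] limI by metis
qed

section \<open>The projective line\<close>

definition proj_rel :: "'a::field ^ 2 \<Rightarrow> 'a ^ 2 \<Rightarrow> bool" where
  "proj_rel u v \<longleftrightarrow> u \<noteq> 0 \<and> v \<noteq> 0 \<and> (\<exists>c. c \<noteq> 0 \<and> v = c *s u)"

lemma proj_rel_part_equivp: "part_equivp (proj_rel :: 'a::field ^ 2 \<Rightarrow> 'a ^ 2 \<Rightarrow> bool)"
proof (rule part_equivpI)
  have "proj_rel 1 (1 :: 'a ^ 2)"
    by (auto simp: proj_rel_def vec_eq_iff intro!: exI[of _ 1])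
  thus "\<exists>u. proj_rel u (u :: 'a ^ 2)" ..
  show "symp (proj_rel :: 'a ^ 2 \<Rightarrow> _)"
  proof (rule sympI)
    fix u v :: "'a ^ 2" assume "proj_rel u v"
    then obtain c where "u \<noteq> 0" "v \<noteq> 0" "c \<noteq> 0" "v = c *s u" by (auto simp: proj_rel_def)
    thus "proj_rel v u" unfolding proj_rel_def
      by (auto intro!: exI[of _ "inverse c"] simp: vector_smult_assoc)
  qed
  show "transp (proj_rel :: 'a ^ 2 \<Rightarrow> _)"
    by (rule transpI) (auto simp: proj_rel_def vector_smult_assoc intro: no_zero_divisors)
qed

quotient_type (overloaded) 'a proj_line = "'a::field ^ 2" / partial: "proj_rel :: 'a ^ 2 \<Rightarrow> 'a ^ 2 \<Rightarrow> bool"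
  by (rule proj_rel_part_equivp)

text \<open>\<open>abs_proj_line v\<close> is the point with homogeneous coordinates \<open>v\<close>; it is meaningful only
  for \<open>v \<noteq> 0\<close>.\<close>

definition cf_matrix :: "nat \<Rightarrow> 'a::field ^ 2 ^ 2" where
  "cf_matrix a = vector [vector [0, 1], vector [1, of_nat a]]"

definition cf_word_matrix :: "nat list \<Rightarrow> 'a::field ^ 2 ^ 2" where
  "cf_word_matrix u = foldr (\<lambda>a M. cf_matrix a ** M) u (mat 1)"

definition is_eigenvector :: "'a::field ^ 'n ^ 'n \<Rightarrow> 'a ^ 'n \<Rightarrow> bool" where
  "is_eigenvector M v \<longleftrightarrow> v \<noteq> 0 \<and> (\<exists>c. M *v v = c *s v)"

lemma cf_matrix_mult_vec: "cf_matrix a *v v = vector [v $ 2, v $ 1 + of_nat a * v $ 2]"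
  by (simp add: cf_matrix_def vec_eq_iff matrix_vector_mult_def forall_2 sum_2)

lift_definition cf_act :: "nat \<Rightarrow> 'a::field proj_line \<Rightarrow> 'a proj_line" is
  "\<lambda>a v. cf_matrix a *v v"
proof -
  fix a :: nat and u v :: "'a ^ 2" assume uv: "proj_rel u v"
  then obtain c where c: "u \<noteq> 0" "v \<noteq> 0" "c \<noteq> 0" "v = c *s u" by (auto simp: proj_rel_def)
  have nz: "cf_matrix a *v x \<noteq> 0" if "x \<noteq> 0" for x :: "'a ^ 2"
    using that by (auto simp: vec_eq_iff forall_2 cf_matrix_mult_vec)
  have "cf_matrix a *v v = c *s (cf_matrix a *v u)"
    by (simp add: c vec_eq_iff forall_2 cf_matrix_mult_vec algebra_simps)
  thus "proj_rel (cf_matrix a *v u) (cf_matrix a *v v)"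
    using c nz unfolding proj_rel_def by blast
qed

section \<open>Badly approximable pairs\<close>

lift_definition is_PBad :: "real \<Rightarrow> 'p::prime_card padic proj_line \<Rightarrow> bool" is
  "\<lambda>\<epsilon> q. \<forall>a b :: int. (a, b) \<noteq> (0, 0) \<longrightarrow>
     padic_abs (of_int a * q $ 1 + of_int b * q $ 2) / max (padic_abs (q $ 1)) (padic_abs (q $ 2))
       \<ge> \<epsilon> / max (real_of_int a ^ 2) (real_of_int b ^ 2)"
proof -
  fix \<epsilon> :: real and u v :: "'p padic ^ 2" assume "proj_rel u v"
  then obtain c where c: "c \<noteq> 0" "v = c *s u" by (auto simp: proj_rel_def)
  have pos: "padic_abs c > 0" using c padic_abs_nonneg[of c] padic_abs_eq_0_iff[of c] by linarith
  have "padic_abs (of_int a * v $ 1 + of_int b * v $ 2) / max (padic_abs (v $ 1)) (padic_abs (v $ 2))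
      = padic_abs (of_int a * u $ 1 + of_int b * u $ 2) / max (padic_abs (u $ 1)) (padic_abs (u $ 2))"
    for a b :: int
  proof -
    have "of_int a * v $ 1 + of_int b * v $ 2 = c * (of_int a * u $ 1 + of_int b * u $ 2)"
      by (simp add: c algebra_simps)
    moreover have "max (padic_abs (v $ 1)) (padic_abs (v $ 2))
        = padic_abs c * max (padic_abs (u $ 1)) (padic_abs (u $ 2))"
      using pos by (simp add: c padic_abs_mult max_mult_distrib_left)
    ultimately show ?thesis using pos by (simp add: padic_abs_mult)
  qed
  thus "(\<forall>a b :: int. (a, b) \<noteq> (0, 0) \<longrightarrow>
     padic_abs (of_int a * u $ 1 + of_int b * u $ 2) / max (padic_abs (u $ 1)) (padic_abs (u $ 2))
       \<ge> \<epsilon> / max (real_of_int a ^ 2) (real_of_int b ^ 2)) =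
    (\<forall>a b :: int. (a, b) \<noteq> (0, 0) \<longrightarrow>
     padic_abs (of_int a * v $ 1 + of_int b * v $ 2) / max (padic_abs (v $ 1)) (padic_abs (v $ 2))
       \<ge> \<epsilon> / max (real_of_int a ^ 2) (real_of_int b ^ 2))"
    by simp
qed

definition PBad :: "real \<Rightarrow> 'p::prime_card padic proj_line set" where
  "PBad \<epsilon> = {q. is_PBad \<epsilon> q}"

definition shift_pair :: "nat stream \<times> 'a::field proj_line \<Rightarrow> nat stream \<times> 'a proj_line" where
  "shift_pair = (\<lambda>(w, q). (stl w, cf_act (shd w) q))"

definition LMad_eps :: "real \<Rightarrow> (nat stream \<times> 'p::prime_card padic proj_line) set" where
  "LMad_eps \<epsilon> = {(w, x). w \<in> streams {1..} \<and>
     (\<forall>n. (shift_pair ^^ n) (w, x) \<in> streams {1..nat \<lfloor>1 / \<epsilon>\<rfloor> + 1} \<times> PBad \<epsilon>)}"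

definition LMad :: "(nat stream \<times> 'p::prime_card padic proj_line) set" where
  "LMad = (\<Union>\<epsilon>\<in>{0<..}. LMad_eps \<epsilon>)"

definition is_period :: "nat stream \<Rightarrow> nat \<Rightarrow> bool" where
  "is_period w k \<longleftrightarrow> k > 0 \<and> sdrop k w = w"

definition is_minimal_period :: "nat stream \<Rightarrow> nat \<Rightarrow> bool" where
  "is_minimal_period w l \<longleftrightarrow> is_period w l \<and> (\<forall>k. is_period w k \<longrightarrow> l \<le> k)"

end

theory Submission
  imports Defs "HOL-Number_Theory.Cong"
begin

text \<open>
  The matrix \<open>B = A\<^sub>w\<^sub>l\<^sup>T\<close> is integral with determinant \<open>\<plusminus>1\<close>, and
  shifting by the period \<open>l\<close> acts on the projective line by \<open>B\<close>. If \<open>x\<close> is not an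
  eigenvector, then its \<open>B\<close>-orbit is a one-dimensional \<open>p\<close>-adic set whose closure contains a
  rational point: for an integer vector \<open>r\<close> close to \<open>x\<close>, the sequence
  \<open>f n = det (r, B\<^sup>n x)\<close> is a linear recurrence with coefficients \<open>tr B\<close> and
  \<open>det B\<close>; along a suitable arithmetic progression its coefficients become \<open>2\<close> and \<open>1\<close>
  modulo \<open>p\<^sup>2\<close>, and a Hensel-type argument gives terms arbitrarily close to \<open>0\<close>. This
  contradicts the uniform bound that defines \<open>PBad\<close>. Conversely, an eigenvector has a periodic
  orbit of quadratic irrational points, because \<open>(tr B)\<^sup>2 - 4 det B\<close> is not a square, and
  Liouville's argument shows that each of them is badly approximable.
\<close>

section \<open>The \<open>p\<close>-adic absolute value\<close>

lemma padic_abs_abs_padic_const: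
  "padic_abs (abs_padic (\<lambda>_. c) :: 'p::prime_card padic) = rat_padic_abs CARD('p) c"
  by (subst padic_abs.abs_eq) (auto simp: padic_rel_refl_iff)

lemma padic_abs_add:
  fixes x y :: "'p::prime_card padic"
  shows "padic_abs (x + y) \<le> max (padic_abs x) (padic_abs y)"
proof transfer
  fix X Y :: "nat \<Rightarrow> rat"
  assume X: "padic_rel CARD('p) X X" and Y: "padic_rel CARD('p) Y Y"
  have XY: "padic_rel CARD('p) (\<lambda>n. X n + Y n) (\<lambda>n. X n + Y n)"
    by (rule padic_rel_add[OF prime_card X Y])
  show "lim (\<lambda>n. rat_padic_abs CARD('p) (X n + Y n))
      \<le> max (lim (\<lambda>n. rat_padic_abs CARD('p) (X n))) (lim (\<lambda>n. rat_padic_abs CARD('p) (Y n)))"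
    by (rule LIMSEQ_le[OF padic_Cauchy_abs_tendsto_lim[OF prime_card XY]
          tendsto_max[OF padic_Cauchy_abs_tendsto_lim[OF prime_card X]
            padic_Cauchy_abs_tendsto_lim[OF prime_card Y]]])
       (auto intro: rat_padic_abs_add[OF prime_card])
qed

lemma padic_abs_0 [simp]: "padic_abs (0 :: 'p::prime_card padic) = 0"
  by (simp add: padic_abs_eq_0_iff)

lemma padic_abs_1 [simp]: "padic_abs (1 :: 'p::prime_card padic) = 1"
  using padic_abs_abs_padic_const[of 1, where 'p='p] by (simp add: one_padic_def)

lemma padic_abs_minus [simp]: "padic_abs (- x) = padic_abs (x :: 'p::prime_card padic)"
proof -
  have "padic_abs (- 1 :: 'p padic) ^ 2 = 1"
    using padic_abs_mult[of "- 1" "- 1 :: 'p padic"] by (simp add: power2_eq_square)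
  hence "padic_abs (- 1 :: 'p padic) = 1"
    using padic_abs_nonneg[of "- 1 :: 'p padic"] by (auto simp: power2_eq_1_iff)
  thus ?thesis using padic_abs_mult[of "- 1" x] by simp
qed

lemma padic_abs_pos_iff: "padic_abs x > 0 \<longleftrightarrow> x \<noteq> (0 :: 'p::prime_card padic)"
  using padic_abs_nonneg[of x] padic_abs_eq_0_iff[of x] by linarith

lemma padic_abs_divide: "padic_abs (x / y) = padic_abs x / padic_abs (y :: 'p::prime_card padic)"
proof (cases "y = 0")
  case False
  thus ?thesis using padic_abs_mult[of "x / y" y] by (simp add: padic_abs_eq_0_iff field_simps)
qed simp

lemma padic_abs_add_le:
  fixes x y :: "'p::prime_card padic"
  shows "padic_abs x \<le> e \<Longrightarrow> padic_abs y \<le> e \<Longrightarrow> padic_abs (x + y) \<le> e"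
  using padic_abs_add[of x y] by linarith

lemma padic_abs_diff_le:
  fixes x y :: "'p::prime_card padic"
  shows "padic_abs x \<le> e \<Longrightarrow> padic_abs y \<le> e \<Longrightarrow> padic_abs (x - y) \<le> e"
  using padic_abs_add_le[of x e "- y"] by simp

lemma padic_abs_mult_le:
  fixes x y :: "'p::prime_card padic"
  shows "padic_abs x \<le> a \<Longrightarrow> padic_abs y \<le> b \<Longrightarrow> padic_abs (x * y) \<le> a * b"
  unfolding padic_abs_mult by (meson mult_mono order_trans padic_abs_nonneg)

text \<open>The isosceles principle: \<open>y\<close> is \<open>(x + y) + (- x)\<close>, and the
  ultrametric bound applied to this sum leaves no room for \<open>x + y\<close> to be smaller than
  \<open>y\<close>.\<close>

lemma padic_abs_add_eq_of_less:
  fixes x y :: "'p::prime_card padic"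
  assumes "padic_abs x < padic_abs y"
  shows "padic_abs (x + y) = padic_abs y"
  using padic_abs_add[of x y] padic_abs_add[of "x + y" "- x"] assms by simp

section \<open>Integers inside the p-adic field\<close>

lemma abs_padic_const_add:
  "abs_padic (\<lambda>_. a) + abs_padic (\<lambda>_. b) = (abs_padic (\<lambda>_. a + b) :: 'p::prime_card padic)"
  by (subst plus_padic.abs_eq) (auto simp: padic_rel_refl_iff)

lemma abs_padic_const_minus:
  "- abs_padic (\<lambda>_. a) = (abs_padic (\<lambda>_. - a) :: 'p::prime_card padic)"
  by (subst uminus_padic.abs_eq) (auto simp: padic_rel_refl_iff)

lemma of_int_padic: "(of_int a :: 'p::prime_card padic) = abs_padic (\<lambda>_. of_int a)"
proof -
  have nat: "(of_nat n :: 'p padic) = abs_padic (\<lambda>_. of_nat n)" for n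
    by (induction n) (simp_all add: zero_padic_def one_padic_def abs_padic_const_add)
  show ?thesis
    by (cases a) (simp_all add: nat abs_padic_const_minus abs_padic_const_add one_padic_def
        flip: add_uminus_conv_diff del: add_uminus_conv_diff of_nat_Suc)
qed

lemma padic_abs_of_int: "padic_abs (of_int a :: 'p::prime_card padic) = rat_padic_abs CARD('p) (of_int a)"
  by (simp add: of_int_padic padic_abs_abs_padic_const)

lemma padic_abs_of_int_le_1: "padic_abs (of_int a :: 'p::prime_card padic) \<le> 1"
  by (simp add: padic_abs_of_int rat_padic_abs_int_le_1[OF prime_card])

lemma padic_abs_of_nat_le_1: "padic_abs (of_nat a :: 'p::prime_card padic) \<le> 1"
  using padic_abs_of_int_le_1[of "int a", where 'p='p] by simp

text \<open>The power of \<open>p\<close> that divides \<open>a\<close> is at most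
  \<open>\<bar>a\<bar>\<close>. Here the archimedean size of an integer bounds its p-adic size from
  below, which Liouville's argument rests on.\<close>

lemma padic_abs_of_int_ge:
  assumes "a \<noteq> 0"
  shows "padic_abs (of_int a :: 'p::prime_card padic) \<ge> 1 / real_of_int \<bar>a\<bar>"
proof -
  let ?k = "multiplicity (int CARD('p)) a"
  have p: "CARD('p) > 0" by simp
  have "int CARD('p) ^ ?k dvd a" by (rule multiplicity_dvd)
  hence "int CARD('p) ^ ?k \<le> \<bar>a\<bar>" using dvd_imp_le_int[OF assms] by fastforce
  hence "real_of_int (int CARD('p) ^ ?k) \<le> real_of_int \<bar>a\<bar>" by linarith
  hence le: "real CARD('p) ^ ?k \<le> real_of_int \<bar>a\<bar>" by simp
  have "padic_abs (of_int a :: 'p padic) = real CARD('p) powi (- int ?k)"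
    using rat_padic_abs_fraction[OF prime_card[where 'a='p] assms, of 1] by (simp add: padic_abs_of_int)
  also have "\<dots> = 1 / real CARD('p) ^ ?k" by (simp add: power_int_minus field_simps)
  also have "\<dots> \<ge> 1 / real_of_int \<bar>a\<bar>"
    using le p by (intro divide_left_mono) (auto simp: assms)
  finally show ?thesis .
qed

lemma padic_of_int_eq_0_iff: "(of_int a :: 'p::prime_card padic) = 0 \<longleftrightarrow> a = 0"
proof
  assume a: "(of_int a :: 'p padic) = 0"
  show "a = 0"
  proof (rule ccontr)
    assume "a \<noteq> 0"
    hence "0 < 1 / real_of_int \<bar>a\<bar>" by simp
    thus False using padic_abs_of_int_ge[OF \<open>a \<noteq> 0\<close>, where 'p='p] a by simp
  qed
qed simp

lemma padic_abs_p: "padic_abs (of_nat CARD('p) :: 'p::prime_card padic) = 1 / real CARD('p)"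
proof -
  have "padic_abs (of_nat CARD('p) :: 'p padic) = rat_padic_abs CARD('p) (of_int (int CARD('p)) / of_int 1)"
    using padic_abs_of_int[of "int CARD('p)", where 'p='p] by simp
  also have "\<dots> = real CARD('p) powi (- 1)"
    using prime_card[where 'a='p]
    by (subst rat_padic_abs_fraction) auto
  finally show ?thesis by (simp add: power_int_minus field_simps)
qed

lemma padic_abs_of_int_dvd:
  assumes "int CARD('p) ^ k dvd a"
  shows "padic_abs (of_int a :: 'p::prime_card padic) \<le> 1 / real CARD('p) ^ k"
proof -
  have pow: "padic_abs (of_nat CARD('p) ^ n :: 'p padic) = 1 / real CARD('p) ^ n" for n
    by (induction n) (simp_all add: padic_abs_mult padic_abs_p)
  obtain c where "a = int CARD('p) ^ k * c" using assms by blast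
  hence "padic_abs (of_int a :: 'p padic) = 1 / real CARD('p) ^ k * padic_abs (of_int c :: 'p padic)"
    by (simp add: padic_abs_mult pow)
  also have "\<dots> \<le> 1 / real CARD('p) ^ k"
    using padic_abs_of_int_le_1[of c, where 'p='p] by (simp add: divide_right_mono)
  finally show ?thesis .
qed

section \<open>Density of the natural numbers in the p-adic integers\<close>

text \<open>In lowest terms the denominator is prime to \<open>p\<close>, as otherwise the absolute
  value would exceed 1. Hence it is invertible modulo \<open>p^k\<close>.\<close>

lemma rat_padic_abs_nat_dense:
  assumes p: "prime p" and y: "rat_padic_abs p y \<le> 1"
  shows "\<exists>j::nat. rat_padic_abs p (y - of_nat j) \<le> 1 / real p ^ k"
proof (cases "y = 0")
  case False
  obtain a b where q: "quotient_of y = (a, b)" by fastforce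
  have yab: "y = of_int a / of_int b" and b: "b > 0" and co: "coprime a b"
    using quotient_of_div[OF q] quotient_of_denom_pos[OF q] quotient_of_coprime[OF q] by auto
  have a: "a \<noteq> 0" using False yab by auto
  have p1: "real p > 1" using prime_gt_1_nat[OF p] by simp
  have mb: "multiplicity (int p) b = 0"
  proof (rule ccontr)
    assume nb: "multiplicity (int p) b \<noteq> 0"
    hence pb: "int p dvd b" by (metis not_dvd_imp_multiplicity_0)
    hence "\<not> int p dvd a" using co p
      by (metis coprime_common_divisor not_prime_unit prime_int_nat_transfer nat_int of_nat_0_le_iff)
    hence na: "multiplicity (int p) a = 0" by (rule not_dvd_imp_multiplicity_0)
    have "rat_padic_abs p y = real p ^ multiplicity (int p) b"
      using rat_padic_abs_fraction[OF p a, of b] b yab na by simp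
    also have "\<dots> > 1" using p1 nb by (simp add: one_less_power)
    finally show False using y by simp
  qed
  have "\<not> int p dvd b"
    using mb b p by (metis less_irrefl multiplicity_eq_zero_iff not_prime_unit prime_int_nat_transfer nat_int of_nat_0_le_iff)
  hence cop: "coprime b (int p ^ k)"
    using p prime_imp_coprime[of "int p" b] by (simp add: coprime_commute)
  then obtain i where i: "[b * i = 1] (mod (int p ^ k))" using cong_solve_coprime_int by blast
  \<comment> \<open>\<open>i\<close> inverts \<open>b\<close>, so \<open>a * i\<close> represents
    the fraction modulo \<open>p^k\<close>; reducing it makes the representative
    nonnegative.\<close>
  define j where "j = (a * i) mod (int p ^ k)"
  have j0: "j \<ge> 0" using p1 by (simp add: j_def)
  have "[b * j = b * (a * i)] (mod (int p ^ k))" unfolding j_def by (intro cong_mult) auto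
  also have "b * (a * i) = a * (b * i)" by simp
  also have "[a * (b * i) = a * 1] (mod (int p ^ k))" using i by (intro cong_mult) auto
  finally have "int p ^ k dvd a - b * j" by (metis cong_iff_dvd_diff cong_sym mult_1_right)
  then obtain c where c: "a - b * j = int p ^ k * c" by blast
  have eq: "y - of_nat (nat j) = of_int (int p ^ k * c) / of_int b"
    using b j0 arg_cong[OF c, of "of_int :: int \<Rightarrow> rat"] by (simp add: yab field_simps)
  have "rat_padic_abs p (y - of_nat (nat j)) \<le> 1 / real p ^ k"
  proof (cases "c = 0")
    case False
    have "rat_padic_abs p (y - of_nat (nat j)) = real p powi (- int (multiplicity (int p) (int p ^ k * c)))"
      using False b p mb p1 by (subst eq, subst rat_padic_abs_fraction) auto
    also have "\<dots> = 1 / real p ^ multiplicity (int p) (int p ^ k * c)"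
      by (simp add: power_int_minus field_simps)
    also have "\<dots> \<le> 1 / real p ^ k"
    proof (intro divide_left_mono power_increasing)
      show "k \<le> multiplicity (int p) (int p ^ k * c)"
        using False p p1 by (intro multiplicity_geI) auto
    qed (use p1 in auto)
    finally show ?thesis .
  qed (use eq in simp)
  thus ?thesis by blast
qed (auto intro!: exI[of _ 0])

text \<open>A late term of a Cauchy sequence for \<open>x\<close> is a rational close to
  \<open>x\<close>, and this rational is close to a natural number.\<close>

lemma padic_nat_dense:
  fixes x :: "'p::prime_card padic"
  assumes x: "padic_abs x \<le> 1" and e: "e > 0"
  shows "\<exists>j::nat. padic_abs (x - of_nat j) < e"
proof -
  have p1: "real CARD('p) > 1" using prime_gt_1_nat[OF prime_card[where 'a='p]] by simp
  \<comment> \<open>\<open>e' < 1\<close> keeps the approximating rational in the unit ball;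
    \<open>e' < e\<close> restores the strict inequality that is lost in the limit.\<close>
  define e' where "e' = min e 1 / 2"
  have e': "e' > 0" "e' < e" "e' < 1" using e by (auto simp: e'_def)
  obtain X where X: "padic_rel CARD('p) X X" "x = abs_padic X"
    using Quotient_padic[where 'p='p] by (metis Quotient_abs_rep Quotient_rep_reflp)
  then obtain M where M: "\<And>m n. m \<ge> M \<Longrightarrow> n \<ge> M \<Longrightarrow> rat_padic_abs CARD('p) (X m - X n) < e'"
    using e'(1) unfolding padic_rel_def padic_Cauchy_def by blast
  let ?y = "abs_padic (\<lambda>_. X M) :: 'p padic"
  have cauchy: "padic_Cauchy CARD('p) (\<lambda>n. X n + - X M)"
    using X(1) by (intro padic_Cauchy_add prime_card) (auto simp: padic_rel_def)
  have "x - ?y = abs_padic (\<lambda>n. X n + - X M)"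
    unfolding X(2) diff_conv_add_uminus abs_padic_const_minus
    by (subst plus_padic.abs_eq) (use X(1) in \<open>auto simp: padic_rel_refl_iff\<close>)
  hence "padic_abs (x - ?y) = lim (\<lambda>n. rat_padic_abs CARD('p) (X n + - X M))"
    using cauchy by (simp only: padic_abs.abs_eq padic_rel_refl_iff)
  also have "\<dots> \<le> e'"
    by (rule LIMSEQ_le_const2[OF padic_Cauchy_abs_tendsto_lim[OF prime_card]])
       (use cauchy M in \<open>auto simp: padic_rel_refl_iff intro!: exI[of _ M] less_imp_le\<close>)
  finally have xy: "padic_abs (x - ?y) \<le> e'" .
  have "padic_abs (x - (x - ?y)) \<le> 1"
    using xy x e'(3) padic_abs_diff_le[of x 1 "x - ?y"] by linarith
  hence "rat_padic_abs CARD('p) (X M) \<le> 1" by (simp add: padic_abs_abs_padic_const)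
  moreover obtain k where k: "1 / real CARD('p) ^ k < e'"
    using real_arch_pow_inv[OF e'(1), of "1 / real CARD('p)"] p1 by (auto simp: power_one_over)
  ultimately obtain j where j: "rat_padic_abs CARD('p) (X M - of_nat j) \<le> e'"
    using rat_padic_abs_nat_dense[OF prime_card] by (meson less_imp_le order_trans)
  have "?y - of_nat j = abs_padic (\<lambda>_. X M - of_nat j)"
    using of_int_padic[of "int j", where 'p='p]
    by (simp only: diff_conv_add_uminus abs_padic_const_minus abs_padic_const_add of_int_of_nat_eq)
  hence "padic_abs (?y - of_nat j) \<le> e'" using j by (simp add: padic_abs_abs_padic_const)
  hence "padic_abs ((x - ?y) + (?y - of_nat j)) \<le> e'" using xy by (intro padic_abs_add_le)
  thus ?thesis using e'(2) by (auto intro: le_less_trans)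
qed

section \<open>Linear recurrences\<close>

text \<open>The companion Lucas sequence: the trace of \<open>M^n\<close> for a 2 by 2 matrix
  \<open>M\<close> with trace \<open>t\<close> and determinant \<open>d\<close>.\<close>

fun lucasV :: "int \<Rightarrow> int \<Rightarrow> nat \<Rightarrow> int" where
  "lucasV t d 0 = 2"
| "lucasV t d (Suc 0) = t"
| "lucasV t d (Suc (Suc n)) = t * lucasV t d (Suc n) - d * lucasV t d n"

text \<open>This is Cayley-Hamilton for \<open>M^m\<close>, whose trace is
  \<open>lucasV t d m\<close> and whose determinant is \<open>d ^ m\<close>. It shows that every
  \<open>m\<close>-th term of a recurrence again forms a recurrence of order two.\<close>

lemma recurrence_stride:
  fixes f :: "nat \<Rightarrow> 'a::comm_ring_1"
  assumes rec: "\<And>n. f (n + 2) = of_int t * f (n + 1) - of_int d * f n"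
  shows "f (n + 2 * m) = of_int (lucasV t d m) * f (n + m) - of_int (d ^ m) * f n"
proof (induction m arbitrary: n rule: induct_nat_012)
  case (ge2 m)
  \<comment> \<open>The hypotheses are used from the starting points \<open>n + 1\<close> and
    \<open>n + 2\<close>, so that both produce the same term \<open>f (n + 2 + m)\<close>.\<close>
  have "f (n + 2 * Suc (Suc m)) = of_int t * f (n + 1 + 2 * Suc m) - of_int d * f (n + 2 + 2 * m)"
    using rec[of "n + 2 + 2 * m"] by (simp add: algebra_simps numeral_eq_Suc)
  also have "f (n + 1 + 2 * Suc m)
      = of_int (lucasV t d (Suc m)) * f (n + 2 + m) - of_int d * of_int d ^ m * f (n + 1)"
    using ge2.IH(2)[of "n + 1"] by (simp add: numeral_eq_Suc)
  also have "f (n + 2 + 2 * m)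
      = of_int (lucasV t d m) * f (n + 2 + m) - of_int d ^ m * (of_int t * f (n + 1) - of_int d * f n)"
    using ge2.IH(1)[of "n + 2"] rec[of n] by simp
  finally show ?case by (simp add: algebra_simps numeral_eq_Suc)
qed (use rec in auto)

text \<open>For \<open>t = 2\<close> and \<open>d = 1\<close> the constant 2 solves the recurrence.
  The congruences thus survive the passage to every \<open>n\<close>-th term.\<close>

lemma lucasV_cong_2:
  assumes "[t = 2] (mod q)" "[d = 1] (mod q)"
  shows "[lucasV t d n = 2] (mod q)"
  using assms
proof (induction t d n rule: lucasV.induct)
  case (3 t d n)
  hence "[t * lucasV t d (Suc n) - d * lucasV t d n = 2 * 2 - 1 * 2] (mod q)"
    by (intro cong_diff cong_mult) auto
  thus ?case by simp
qed auto

text \<open>Among finitely many residue states two coincide. As \<open>d\<close> is a unit the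
  recurrence also runs backwards, so the coincidence moves down to index 0, where the values are 2
  and 1.\<close>

lemma lucasV_return:
  fixes t d q :: int
  assumes d: "d = 1 \<or> d = - 1" and q: "q > 0"
  obtains m where "m > 0" "[lucasV t d m = 2] (mod q)" "d ^ m = 1"
proof -
  \<comment> \<open>Two consecutive residues determine the sequence modulo \<open>q\<close>; the
    third component makes the sign \<open>d ^ n\<close> return at the same time.\<close>
  define s where "s n = (lucasV t d n mod q, lucasV t d (Suc n) mod q, d ^ n)" for n
  have dd: "d * d = 1" using d by auto
  have "d ^ n \<in> {1, - 1}" for n by (induction n) (use d in auto)
  hence "range s \<subseteq> {0..<q} \<times> {0..<q} \<times> {1, - 1}" using q by (auto simp: s_def)
  hence "finite (range s)" by (rule finite_subset) auto
  hence "\<not> inj s" using finite_imageD by blast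
  then obtain i j where "s i = s j" "i \<noteq> j" by (auto simp: inj_def)
  then obtain i j where ij: "s i = s j" "i < j" by (metis linorder_neqE_nat)
  have step_back: "s n = s (n + k)" if "s (Suc n) = s (Suc (n + k))" for n k
  proof -
    \<comment> \<open>Since \<open>d\<close> is its own inverse, the recurrence can be solved for
      its oldest term.\<close>
    have V: "lucasV t d n = d * (t * lucasV t d (Suc n) - lucasV t d (Suc (Suc n)))" for n
    proof -
      have "d * (t * lucasV t d (Suc n) - lucasV t d (Suc (Suc n))) = (d * d) * lucasV t d n"
        by (simp add: algebra_simps)
      thus ?thesis by (simp only: dd mult_1)
    qed
    have eq: "lucasV t d (Suc n) mod q = lucasV t d (Suc (n + k)) mod q"
      "lucasV t d (Suc (Suc n)) mod q = lucasV t d (Suc (Suc (n + k))) mod q"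
      "d * d ^ n = d * d ^ (n + k)"
      using that by (auto simp: s_def)
    have "d * t * lucasV t d (Suc n) mod q = d * t * lucasV t d (Suc (n + k)) mod q"
      "d * lucasV t d (Suc (Suc n)) mod q = d * lucasV t d (Suc (Suc (n + k))) mod q"
      using eq(1,2) by (metis mod_mult_right_eq)+
    hence "lucasV t d n mod q = lucasV t d (n + k) mod q"
      unfolding V[of n] V[of "n + k"] right_diff_distrib mult.assoc[symmetric]
      by (rule mod_diff_cong)
    thus ?thesis using eq(1,3) d by (auto simp: s_def)
  qed
  have "s 0 = s k" if "s n = s (n + k)" for n k
    using that
  proof (induction n)
    case (Suc n)
    thus ?case using step_back[of n k] by (metis add_Suc)
  qed (metis add_0)
  hence "s 0 = s (j - i)" using ij by (metis le_add_diff_inverse less_imp_le)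
  thus ?thesis using ij(2) by (intro that[of "j - i"]) (auto simp: s_def cong_def)
qed

text \<open>With coefficients exactly 2 and 1 the second differences vanish. The deviation
  \<open>h\<close> obeys that recurrence up to a perturbation of size \<open>1 / p^k\<close>, and by
  the ultrametric inequality such errors do not accumulate.\<close>

lemma recurrence_near_linear:
  fixes g :: "nat \<Rightarrow> 'p::prime_card padic"
  assumes rec: "\<And>n. g (n + 2) = of_int t * g (n + 1) - of_int d * g n"
    and t: "[t = 2] (mod int CARD('p) ^ k)" and d: "[d = 1] (mod int CARD('p) ^ k)"
    and g: "padic_abs (g 0) \<le> 1" "padic_abs (g 1) \<le> 1"
  shows "padic_abs (g n - (g 0 + of_nat n * (g 1 - g 0))) \<le> 1 / real CARD('p) ^ k"
proof -
  let ?e = "1 / real CARD('p) ^ k"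
  have int: "padic_abs (of_int a * x) \<le> e" if "padic_abs x \<le> e" for a e and x :: "'p padic"
    using padic_abs_mult_le[OF padic_abs_of_int_le_1 that, of a] by simp
  have "padic_abs (g n) \<le> 1 \<and> padic_abs (g (n + 1)) \<le> 1" for n
    using g rec by (induction n) (auto intro!: padic_abs_diff_le int)
  hence bound: "padic_abs (g n) \<le> 1" for n by blast
  have small: "padic_abs (of_int a * x) \<le> ?e"
    if "int CARD('p) ^ k dvd a" "padic_abs x \<le> 1" for a and x :: "'p padic"
    using padic_abs_mult_le[OF padic_abs_of_int_dvd[OF that(1)] that(2)] by simp
  define h where "h n = g n - (g 0 + of_nat n * (g 1 - g 0))" for n
  have h_rec: "h (n + 2) = of_int (t - 2) * g (n + 1) - of_int (d - 1) * g n
      + (of_int 2 * h (n + 1) - h n)" for n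
    unfolding h_def rec by (simp add: algebra_simps)
  have td: "int CARD('p) ^ k dvd t - 2" "int CARD('p) ^ k dvd d - 1"
    using t d by (simp_all add: cong_iff_dvd_diff)
  have "padic_abs (h n) \<le> ?e \<and> padic_abs (h (n + 1)) \<le> ?e" for n
  proof (induction n)
    case (Suc n)
    have "padic_abs (h (n + 2)) \<le> ?e"
      unfolding h_rec
      by (intro padic_abs_add_le padic_abs_diff_le small td bound int) (use Suc in auto)
    thus ?case using Suc by simp
  qed (simp add: h_def)
  thus ?thesis unfolding h_def by blast
qed

text \<open>Modulo \<open>p\<^sup>2\<close> the sequence is an arithmetic progression with unit difference, so some
  \<open>g (p * j)\<close> is divisible by \<open>p\<^sup>2\<close>. The sequence \<open>m \<mapsto> g (p * j + p * m) / p\<close> then satisfies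
  the same hypotheses.\<close>

lemma recurrence_small_value:
  fixes g :: "nat \<Rightarrow> 'p::prime_card padic"
  assumes "\<And>n. g (n + 2) = of_int t * g (n + 1) - of_int d * g n"
    and "[t = 2] (mod int CARD('p) ^ 2)" and "[d = 1] (mod int CARD('p) ^ 2)"
    and "padic_abs (g 0) \<le> 1 / real CARD('p)" and "padic_abs (g 1) = 1"
  shows "\<exists>n. padic_abs (g n) \<le> 1 / real CARD('p) ^ k"
  using assms
proof (induction k arbitrary: g t d)
  case 0
  thus ?case by (auto intro!: exI[of _ 1])
next
  case (Suc k)
  note rec = Suc.prems(1) and td = Suc.prems(2,3) and g0 = Suc.prems(4) and g1 = Suc.prems(5)
  let ?p = "CARD('p)" and ?P = "of_nat CARD('p) :: 'p padic"
  have p1: "real ?p > 1" using prime_gt_1_nat[OF prime_card[where 'a='p]] by simp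
  hence P0: "?P \<noteq> 0" using padic_abs_p[where 'p='p] by (auto simp flip: padic_abs_pos_iff)
  have g0': "padic_abs (g 0) \<le> 1" using g0 p1 by (smt (verit) divide_le_eq_1)
  have g1nz: "g 1 \<noteq> 0" using g1 by auto
  note lin = recurrence_near_linear[OF rec td g0' eq_refl[OF g1]]
  \<comment> \<open>The exact root of \<open>g 0 + p x g 1 = 0\<close>. It is a p-adic integer
    because \<open>g 0\<close> is divisible by \<open>p\<close> and \<open>g 1\<close> is a
    unit.\<close>
  define x where "x = - g 0 / (?P * g 1)"
  have "padic_abs x \<le> 1"
    using g0 p1 by (simp add: x_def padic_abs_divide padic_abs_mult padic_abs_p g1[simplified] field_simps)
  then obtain j where j: "padic_abs (x - of_nat j) < 1 / real ?p"
    using padic_nat_dense[of x "1 / real ?p"] p1 by auto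
  \<comment> \<open>The slope of the linear approximation is \<open>g 1 - g 0\<close>; at indices
    divisible by \<open>p\<close>, replacing it by \<open>g 1\<close> costs only multiples of
    \<open>p * g 0\<close>.\<close>
  have pg0: "padic_abs (?P * g 0) \<le> 1 / real ?p ^ 2"
    using padic_abs_mult_le[OF eq_refl[OF padic_abs_p] g0] by (simp add: power2_eq_square)
  have main: "padic_abs (g (?p * j + ?p * m) - of_nat m * (?P * g 1)) \<le> 1 / real ?p ^ 2" for m
  proof -
    let ?n = "?p * j + ?p * m"
    have "g 0 = - (?P * g 1 * x)" using P0 g1nz by (simp add: x_def)
    hence eq: "g ?n - of_nat m * (?P * g 1) = (g ?n - (g 0 + of_nat ?n * (g 1 - g 0)))
       - ?P * (x - of_nat j) * g 1 - of_nat (j + m) * (?P * g 0)"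
      by (simp add: algebra_simps)
    have "padic_abs (?P * (x - of_nat j) * g 1) \<le> 1 / real ?p * (1 / real ?p) * 1"
      using j g1 by (intro padic_abs_mult_le) (auto simp: padic_abs_p)
    hence 1: "padic_abs (?P * (x - of_nat j) * g 1) \<le> 1 / real ?p ^ 2"
      by (simp add: power2_eq_square)
    have 2: "padic_abs (of_nat (j + m) * (?P * g 0)) \<le> 1 / real ?p ^ 2"
      using padic_abs_mult_le[OF padic_abs_of_nat_le_1 pg0, of "j + m"] by (simp only: mult_1)
    show ?thesis unfolding eq by (rule padic_abs_diff_le[OF padic_abs_diff_le[OF lin 1] 2])
  qed
  define g' where "g' m = g (?p * j + ?p * m) / ?P" for m
  have "\<exists>n. padic_abs (g' n) \<le> 1 / real ?p ^ k"
  proof (rule Suc.IH)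
    show "g' (n + 2) = of_int (lucasV t d ?p) * g' (n + 1) - of_int (d ^ ?p) * g' n" for n
      using recurrence_stride[where f=g and m="?p" and n="?p * j + ?p * n", OF rec] P0
      by (simp add: g'_def field_simps mult_2_right)
    show "[lucasV t d ?p = 2] (mod int ?p ^ 2)" using td by (rule lucasV_cong_2)
    show "[d ^ ?p = 1] (mod int ?p ^ 2)" using cong_pow[OF td(2), of "?p"] by simp
    show "padic_abs (g' 0) \<le> 1 / real ?p"
      using main[of 0] p1 by (simp add: g'_def padic_abs_divide padic_abs_p field_simps power2_eq_square)
    \<comment> \<open>For \<open>m = 1\<close> the main term has absolute value exactly
      \<open>1 / p\<close> and dominates the error, so \<open>g' 1\<close> is a unit again.\<close>
    have "1 / real ?p ^ 2 < 1 / real ?p" using p1 by (simp add: field_simps power2_eq_square)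
    hence "padic_abs (g (?p * j + ?p * 1) - of_nat 1 * (?P * g 1)) < padic_abs (?P * g 1)"
      using main[of 1] unfolding padic_abs_mult padic_abs_p g1 by linarith
    from padic_abs_add_eq_of_less[OF this]
    have "padic_abs (g (?p * j + ?p * 1)) = 1 / real ?p"
      by (simp add: padic_abs_mult padic_abs_p g1[simplified])
    thus "padic_abs (g' 1) = 1" using p1 by (simp add: g'_def padic_abs_divide padic_abs_p)
  qed
  then obtain n where "padic_abs (g' n) \<le> 1 / real ?p ^ k" ..
  hence "padic_abs (g (?p * j + ?p * n)) \<le> 1 / real ?p ^ Suc k"
    using p1 by (simp add: g'_def padic_abs_divide padic_abs_p field_simps)
  thus ?case ..
qed

section \<open>Orbits of an integer matrix near a rational point\<close>

text \<open>The Lucas sequence of the first kind: the coefficient of \<open>M\<close> when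
  \<open>M^n\<close> is written as a combination of \<open>M\<close> and the identity.\<close>

fun lucasU :: "int \<Rightarrow> int \<Rightarrow> nat \<Rightarrow> int" where
  "lucasU t d 0 = 0"
| "lucasU t d (Suc 0) = 1"
| "lucasU t d (Suc (Suc n)) = t * lucasU t d (Suc n) - d * lucasU t d n"

text \<open>Monotonicity is carried through the induction, as it controls the subtraction when
  \<open>d = 1\<close>. Nonvanishing ensures that a vector which is not an eigenvector of
  \<open>M\<close> is not one of \<open>M^n\<close> either.\<close>

lemma lucasU_pos:
  assumes "d = - 1 \<and> t \<ge> 1 \<or> d = 1 \<and> t \<ge> 2" "n > 0"
  shows "lucasU t d n > 0"
proof -
  have "0 \<le> lucasU t d n \<and> lucasU t d n \<le> lucasU t d (Suc n) \<and> 0 < lucasU t d (Suc n)" for n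
  proof (induction n)
    case (Suc n)
    have "lucasU t d (Suc n) \<le> t * lucasU t d (Suc n) - d * lucasU t d n"
      using assms(1)
    proof
      assume dt: "d = - 1 \<and> t \<ge> 1"
      hence "1 * lucasU t d (Suc n) \<le> t * lucasU t d (Suc n)"
        using Suc by (intro mult_right_mono) auto
      moreover have "d * lucasU t d n = - lucasU t d n" using dt by simp
      ultimately show ?thesis using Suc by linarith
    next
      assume dt: "d = 1 \<and> t \<ge> 2"
      hence "2 * lucasU t d (Suc n) \<le> t * lucasU t d (Suc n)"
        using Suc by (intro mult_right_mono) auto
      moreover have "d * lucasU t d n = lucasU t d n" using dt by simp
      ultimately show ?thesis using Suc by linarith
    qed
    thus ?case using Suc by auto
  qed simp
  thus ?thesis using assms(2) by (metis gr0_implies_Suc)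
qed

text \<open>The solutions that vanish at 0 are determined by their value at 1, and
  \<open>lucasU\<close> is the one with value 1 there.\<close>

lemma recurrence_eq_lucasU:
  fixes f :: "nat \<Rightarrow> 'a::comm_ring_1"
  assumes rec: "\<And>n. f (n + 2) = of_int t * f (n + 1) - of_int d * f n" and "f 0 = 0"
  shows "f n = of_int (lucasU t d n) * f 1"
proof (induction n rule: induct_nat_012)
  case (ge2 n)
  thus ?case using rec[of n] by (simp add: algebra_simps)
qed (use assms in auto)

text \<open>An integer vector \<open>(r, s)\<close> close to \<open>y 0\<close> is approximated arbitrarily well by the orbit,
  since the determinant of \<open>(r, s)\<close> and \<open>y n\<close> is a linear recurrence in \<open>n\<close>
  (Cayley--Hamilton).\<close>

lemma matrix_orbit_approaches_rational:
  fixes y :: "nat \<Rightarrow> 'p::prime_card padic ^ 2" and \<alpha> \<beta> \<gamma> \<delta> :: int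
  assumes y: "\<And>n. y (Suc n) $ 1 = of_int \<alpha> * y n $ 1 + of_int \<beta> * y n $ 2"
      "\<And>n. y (Suc n) $ 2 = of_int \<gamma> * y n $ 1 + of_int \<delta> * y n $ 2"
    and td: "\<alpha> * \<delta> - \<beta> * \<gamma> = - 1 \<and> \<alpha> + \<delta> \<ge> 1 \<or> \<alpha> * \<delta> - \<beta> * \<gamma> = 1 \<and> \<alpha> + \<delta> \<ge> 2"
    and norm: "max (padic_abs (y 0 $ 1)) (padic_abs (y 0 $ 2)) = 1"
    and indep: "y 0 $ 1 * y 1 $ 2 \<noteq> y 0 $ 2 * y 1 $ 1"
  shows "\<exists>a b :: int. (a, b) \<noteq> (0, 0) \<and>
    (\<forall>e>0. \<exists>n. padic_abs (of_int a * y n $ 1 + of_int b * y n $ 2) < e)"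
proof -
  define t d where "t = \<alpha> + \<delta>" and "d = \<alpha> * \<delta> - \<beta> * \<gamma>"
  have p1: "real CARD('p) > 1" using prime_gt_1_nat[OF prime_card[where 'a='p]] by simp
  define f where "f r s n = r * y n $ 2 - s * y n $ 1" for r s n
  have rec: "f r s (n + 2) = of_int t * f r s (n + 1) - of_int d * f r s n" for r s n
    by (simp add: f_def y t_def d_def algebra_simps)
  \<comment> \<open>Along the progression of step \<open>m\<close> the coefficients become
    \<open>lucasV t d m\<close> and 1, as \<open>recurrence_small_value\<close> requires.\<close>
  obtain m where m: "m > 0" "[lucasV t d m = 2] (mod int CARD('p) ^ 2)" "d ^ m = 1"
    using lucasV_return[of d "int CARD('p) ^ 2" t] td p1 by (auto simp: d_def)
  let ?v1 = "y 0 $ 1" and ?v2 = "y 0 $ 2"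
  \<comment> \<open>The determinant of \<open>y 0\<close> and \<open>y n\<close>: zero at 0, but
    nonzero at \<open>m\<close> by independence of \<open>y 0\<close> and
    \<open>y 1\<close>.\<close>
  let ?F = "f ?v1 ?v2"
  have "?F m = of_int (lucasU t d m) * ?F 1"
    by (rule recurrence_eq_lucasU[OF rec]) (simp add: f_def)
  moreover have "?F 1 \<noteq> 0" using indep by (simp add: f_def)
  moreover have "lucasU t d m > 0" using td m(1) by (intro lucasU_pos) (auto simp: t_def d_def)
  ultimately have Fm: "?F m \<noteq> 0" by (simp add: padic_of_int_eq_0_iff)
  have Y: "padic_abs (y n $ 1) \<le> 1 \<and> padic_abs (y n $ 2) \<le> 1" for n
  proof (induction n)
    case (Suc n)
    have "padic_abs (of_int a * x) \<le> 1" if "padic_abs x \<le> 1" for a and x :: "'p padic"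
      using padic_abs_mult_le[OF padic_abs_of_int_le_1 that, of a] by simp
    thus ?case using Suc by (auto simp: y intro!: padic_abs_add_le)
  qed (use norm in \<open>simp add: max_def split: if_splits\<close>)
  \<comment> \<open>Precision \<open>e\<close> keeps the absolute value of the determinant at
    \<open>m\<close> and makes the one at 0 smaller by a factor \<open>p\<close>. The minimum with 1
    makes \<open>e < 1\<close>, which prevents \<open>(r, s)\<close> from being zero.\<close>
  define e where "e = min 1 (padic_abs (?F m)) / real CARD('p)"
  have e: "e > 0" "e < 1" "e < padic_abs (?F m)" "e \<le> padic_abs (?F m) / real CARD('p)"
  proof -
    have pos: "padic_abs (?F m) > 0" using Fm by (simp add: padic_abs_pos_iff)
    show "e > 0" using pos p1 by (simp add: e_def)
    show le: "e \<le> padic_abs (?F m) / real CARD('p)"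
      using p1 by (simp add: e_def divide_right_mono)
    also have "\<dots> < padic_abs (?F m)" using pos p1 by (simp add: divide_less_eq)
    finally show "e < padic_abs (?F m)" .
    have "e \<le> 1 / real CARD('p)" using p1 by (simp add: e_def divide_right_mono)
    also have "\<dots> < 1" using p1 by simp
    finally show "e < 1" .
  qed
  obtain r :: nat where r: "padic_abs (?v1 - of_nat r) < e"
    using padic_nat_dense[OF conjunct1[OF Y[of 0]] e(1)] by blast
  obtain s :: nat where s: "padic_abs (?v2 - of_nat s) < e"
    using padic_nat_dense[OF conjunct2[OF Y[of 0]] e(1)] by blast
  let ?g = "f (of_nat r) (of_nat s)"
  have close: "padic_abs (?g n - ?F n) \<le> e" for n
  proof -
    have "?g n - ?F n = (?v2 - of_nat s) * y n $ 1 - (?v1 - of_nat r) * y n $ 2"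
      by (simp add: f_def algebra_simps)
    moreover have "padic_abs ((?v2 - of_nat s) * y n $ 1) \<le> e * 1"
      "padic_abs ((?v1 - of_nat r) * y n $ 2) \<le> e * 1"
      using r s Y[of n] by (intro padic_abs_mult_le; simp)+
    ultimately show ?thesis by (auto intro: padic_abs_diff_le)
  qed
  have gm: "padic_abs (?g m) = padic_abs (?F m)"
    using padic_abs_add_eq_of_less[of "?g m - ?F m" "?F m"] close[of m] e(3) by simp
  hence gm0: "padic_abs (?g m) > 0" using Fm by (simp add: padic_abs_pos_iff)
  have "?F 0 = 0" by (simp add: f_def)
  hence g0: "padic_abs (?g 0) \<le> padic_abs (?g m) / real CARD('p)"
    using close[of 0] e(4) gm by simp
  show ?thesis
  proof (rule exI[of _ "- int s"], rule exI[of _ "int r"], intro conjI allI impI)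
    show "(- int s, int r) \<noteq> (0, 0)"
      using r s e(2) norm by (intro notI) (auto simp: max_def split: if_splits)
    fix e' :: real assume e': "e' > 0"
    obtain k where k: "1 / real CARD('p) ^ k < e' / padic_abs (?g m)"
      using real_arch_pow_inv[of "e' / padic_abs (?g m)" "1 / real CARD('p)"] p1 e' gm0
      by (auto simp: power_one_over)
    \<comment> \<open>Division by \<open>?g m\<close> turns the value at 1 into a unit and the value
      at 0 into a multiple of \<open>p\<close>.\<close>
    define g where "g n = ?g (n * m) / ?g m" for n
    have "\<exists>n. padic_abs (g n) \<le> 1 / real CARD('p) ^ k"
    proof (rule recurrence_small_value)
      show "g (n + 2) = of_int (lucasV t d m) * g (n + 1) - of_int 1 * g n" for n
        using recurrence_stride[where f="?g" and m=m and n="n * m", OF rec] gm0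
        by (simp add: g_def m(3) padic_abs_pos_iff field_simps mult_2_right)
      show "padic_abs (g 0) \<le> 1 / real CARD('p)" "padic_abs (g 1) = 1"
        using g0 gm0 by (auto simp: g_def padic_abs_divide field_simps)
    qed (use m in auto)
    then obtain n where "padic_abs (g n) \<le> 1 / real CARD('p) ^ k" ..
    hence "padic_abs (g n) < e' / padic_abs (?g m)" using k by linarith
    hence "padic_abs (?g (n * m)) < e'" using gm0 by (simp add: g_def padic_abs_divide field_simps)
    thus "\<exists>n. padic_abs (of_int (- int s) * y n $ 1 + of_int (int r) * y n $ 2) < e'"
      by (auto simp: f_def)
  qed
qed

section \<open>Badly approximable points\<close>

text \<open>For \<open>d = 1\<close> the number lies strictly between the squares of
  \<open>t - 1\<close> and \<open>t\<close>. For \<open>d = - 1\<close> it lies between those of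
  \<open>t\<close> and \<open>t + 2\<close>, and parity excludes the square of
  \<open>t + 1\<close>.\<close>

lemma discriminant_not_square:
  fixes t d k :: int
  assumes "d = - 1 \<and> t \<ge> 1 \<or> d = 1 \<and> t \<ge> 3"
  shows "t\<^sup>2 - 4 * d \<noteq> k\<^sup>2"
proof
  assume eq: "t\<^sup>2 - 4 * d = k\<^sup>2"
  define j where "j = \<bar>k\<bar>"
  have j: "j \<ge> 0" "j * j = t * t - 4 * d" using eq by (auto simp: j_def power2_eq_square)
  from assms show False
  proof
    assume d: "d = - 1 \<and> t \<ge> 1"
    have "t < j"
    proof (rule ccontr)
      assume "\<not> t < j"
      hence "j * j \<le> t * t" using j by (intro mult_mono) auto
      thus False using d j by simp
    qed
    moreover have "j < t + 2"
    proof (rule ccontr)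
      assume "\<not> j < t + 2"
      hence "(t + 2) * (t + 2) \<le> j * j" using d by (intro mult_mono) auto
      thus False using d j by (simp add: algebra_simps)
    qed
    ultimately have "j = t + 1" by simp
    hence "2 * t = 3" using d j by (simp add: algebra_simps)
    thus False by presburger
  next
    assume d: "d = 1 \<and> t \<ge> 3"
    have "j < t"
    proof (rule ccontr)
      assume "\<not> j < t"
      hence "t * t \<le> j * j" using d by (intro mult_mono) auto
      thus False using d j by simp
    qed
    hence "j * j \<le> (t - 1) * (t - 1)" using j by (intro mult_mono) auto
    thus False using d j by (simp add: algebra_simps)
  qed
qed

text \<open>The form is the determinant of \<open>(a, b)\<close> and its image, so its zeros are the
  eigenvectors. Completing the square, an integral zero would make the discriminant
  \<open>tr^2 - 4 det\<close> a square.\<close>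

lemma fixed_point_form_anisotropic:
  fixes \<alpha> \<beta> \<gamma> \<delta> a b :: int
  assumes \<gamma>: "\<gamma> \<noteq> 0"
    and td: "\<alpha> * \<delta> - \<beta> * \<gamma> = - 1 \<and> \<alpha> + \<delta> \<ge> 1 \<or> \<alpha> * \<delta> - \<beta> * \<gamma> = 1 \<and> \<alpha> + \<delta> \<ge> 3"
    and ab: "(a, b) \<noteq> (0, 0)"
  shows "\<gamma> * a\<^sup>2 + (\<delta> - \<alpha>) * a * b + (- \<beta>) * b\<^sup>2 \<noteq> 0"
proof
  assume Q: "\<gamma> * a\<^sup>2 + (\<delta> - \<alpha>) * a * b + (- \<beta>) * b\<^sup>2 = 0"
  have b: "b \<noteq> 0" using Q ab \<gamma> by auto
  let ?D = "(\<alpha> + \<delta>)\<^sup>2 - 4 * (\<alpha> * \<delta> - \<beta> * \<gamma>)"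
  have "(2 * \<gamma> * a + (\<delta> - \<alpha>) * b)\<^sup>2
      = 4 * \<gamma> * (\<gamma> * a\<^sup>2 + (\<delta> - \<alpha>) * a * b + (- \<beta>) * b\<^sup>2) + ?D * b\<^sup>2"
    by (simp add: algebra_simps power2_eq_square)
  hence sq: "(2 * \<gamma> * a + (\<delta> - \<alpha>) * b)\<^sup>2 = ?D * b\<^sup>2" using Q by simp
  hence "b\<^sup>2 dvd (2 * \<gamma> * a + (\<delta> - \<alpha>) * b)\<^sup>2" by simp
  hence "b dvd 2 * \<gamma> * a + (\<delta> - \<alpha>) * b" by (simp only: pow_divides_pow_iff zero_less_numeral)
  then obtain k where "2 * \<gamma> * a + (\<delta> - \<alpha>) * b = b * k" by blast
  with sq have "?D * b\<^sup>2 = k\<^sup>2 * b\<^sup>2" by (simp only: power_mult_distrib mult.commute)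
  hence "?D = k\<^sup>2" using b by simp
  thus False using discriminant_not_square[OF td] by blast
qed

lemma is_PBad_abs_proj_line:
  fixes v :: "'p::prime_card padic ^ 2"
  assumes "v \<noteq> 0"
  shows "is_PBad \<epsilon> (abs_proj_line v) \<longleftrightarrow> (\<forall>a b :: int. (a, b) \<noteq> (0, 0) \<longrightarrow>
     padic_abs (of_int a * v $ 1 + of_int b * v $ 2) / max (padic_abs (v $ 1)) (padic_abs (v $ 2))
       \<ge> \<epsilon> / max (real_of_int a ^ 2) (real_of_int b ^ 2))"
  by (rule is_PBad.abs_eq) (use assms in \<open>auto simp: proj_rel_def intro!: exI[of _ 1]\<close>)

lemma padic_max_pos:
  fixes v :: "'p::prime_card padic ^ 2"
  assumes "v \<noteq> 0"
  shows "max (padic_abs (v $ 1)) (padic_abs (v $ 2)) > 0"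
  using assms by (auto simp: vec_eq_iff forall_2 less_max_iff_disj padic_abs_pos_iff)

text \<open>A Liouville argument: for \<open>L = a v\<^sub>1 + b v\<^sub>2\<close> the products \<open>v\<^sub>1\<^sup>2 Q(b, -a)\<close> and
  \<open>v\<^sub>2\<^sup>2 Q(b, -a)\<close> are divisible by \<open>L\<close>, while \<open>Q(b, -a)\<close> is a nonzero integer.\<close>

lemma is_PBad_of_isotropic:
  fixes v :: "'p::prime_card padic ^ 2" and A B C :: int
  assumes v: "v \<noteq> 0"
    and zero: "of_int A * (v $ 1)\<^sup>2 + of_int B * v $ 1 * v $ 2 + of_int C * (v $ 2)\<^sup>2 = 0"
    and aniso: "\<And>a b :: int. (a, b) \<noteq> (0, 0) \<Longrightarrow> A * a\<^sup>2 + B * a * b + C * b\<^sup>2 \<noteq> 0"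
  obtains \<epsilon> where "\<epsilon> > 0" "is_PBad \<epsilon> (abs_proj_line v)"
proof -
  let ?S = "real_of_int (\<bar>A\<bar> + \<bar>B\<bar> + \<bar>C\<bar>)"
  let ?M = "max (padic_abs (v $ 1)) (padic_abs (v $ 2))"
  have M: "?M > 0" by (rule padic_max_pos[OF v])
  have "A \<noteq> 0" using aniso[of 1 0] by simp
  hence S: "?S > 0" by linarith
  have "padic_abs (of_int a * v $ 1 + of_int b * v $ 2) / ?M
       \<ge> 1 / ?S / max (real_of_int a ^ 2) (real_of_int b ^ 2)" if ab: "(a, b) \<noteq> (0, 0)" for a b :: int
  proof -
    let ?L = "of_int a * v $ 1 + of_int b * v $ 2"
    let ?m = "max (real_of_int a ^ 2) (real_of_int b ^ 2)"
    define q where "q = A * b\<^sup>2 + B * b * (- a) + C * (- a)\<^sup>2"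
    have q0: "q \<noteq> 0" unfolding q_def using ab by (intro aniso) auto
    have int: "padic_abs (of_int c * x) \<le> ?M" if "padic_abs x \<le> ?M" for c and x :: "'p padic"
      using padic_abs_mult_le[OF padic_abs_of_int_le_1 that, of c] by simp
    have L: "padic_abs ?L \<le> ?M" by (intro padic_abs_add_le int) auto
    \<comment> \<open>Obtained by substituting \<open>a v1 = L - b v2\<close> into
      \<open>a^2 Q(v)\<close>; the twin identity below substitutes \<open>b v2 = L - a v1\<close>
      into \<open>b^2 Q(v)\<close>.\<close>
    have "(v $ 2)\<^sup>2 * of_int q = ?L * (of_int A * ?L - of_int (2 * A * a) * v $ 1 - of_int (B * a) * v $ 2)
      + of_int (a\<^sup>2) * (of_int A * (v $ 1)\<^sup>2 + of_int B * v $ 1 * v $ 2 + of_int C * (v $ 2)\<^sup>2)"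
      by (simp add: q_def algebra_simps power2_eq_square)
    hence 2: "(v $ 2)\<^sup>2 * of_int q = ?L * (of_int A * ?L - of_int (2 * A * a) * v $ 1 - of_int (B * a) * v $ 2)"
      using zero by simp
    have "(v $ 1)\<^sup>2 * of_int q = ?L * (of_int C * ?L - of_int (B * b) * v $ 1 - of_int (2 * C * b) * v $ 2)
      + of_int (b\<^sup>2) * (of_int A * (v $ 1)\<^sup>2 + of_int B * v $ 1 * v $ 2 + of_int C * (v $ 2)\<^sup>2)"
      by (simp add: q_def algebra_simps power2_eq_square)
    hence 1: "(v $ 1)\<^sup>2 * of_int q = ?L * (of_int C * ?L - of_int (B * b) * v $ 1 - of_int (2 * C * b) * v $ 2)"
      using zero by simp
    have "padic_abs ((v $ 1)\<^sup>2 * of_int q) \<le> padic_abs ?L * ?M"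
      unfolding 1 by (intro padic_abs_mult_le order_refl padic_abs_diff_le int L) auto
    moreover have "padic_abs ((v $ 2)\<^sup>2 * of_int q) \<le> padic_abs ?L * ?M"
      unfolding 2 by (intro padic_abs_mult_le order_refl padic_abs_diff_le int L) auto
    \<comment> \<open>The bound for the larger of the two coordinates is the one that is
      kept.\<close>
    ultimately have "?M * ?M * padic_abs (of_int q :: 'p padic) \<le> padic_abs ?L * ?M"
      by (cases "padic_abs (v $ 1) \<le> padic_abs (v $ 2)")
         (auto simp: padic_abs_mult power2_eq_square max_def)
    hence le: "padic_abs (of_int q :: 'p padic) \<le> padic_abs ?L / ?M"
      using M by (simp add: pos_le_divide_eq mult.commute mult.left_commute)
    have sq: "real_of_int a ^ 2 \<le> ?m" "real_of_int b ^ 2 \<le> ?m" by simp_all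
    have "\<bar>real_of_int a * real_of_int b\<bar> \<le> ?m"
    proof (cases "\<bar>a\<bar> \<le> \<bar>b\<bar>")
      case True
      hence "\<bar>real_of_int a\<bar> * \<bar>real_of_int b\<bar> \<le> \<bar>real_of_int b\<bar> * \<bar>real_of_int b\<bar>"
        by (intro mult_right_mono) auto
      thus ?thesis using sq by (simp add: abs_mult power2_eq_square)
    next
      case False
      hence "\<bar>real_of_int a\<bar> * \<bar>real_of_int b\<bar> \<le> \<bar>real_of_int a\<bar> * \<bar>real_of_int a\<bar>"
        by (intro mult_left_mono) auto
      thus ?thesis using sq by (simp add: abs_mult power2_eq_square)
    qed
    hence bnd: "\<bar>real_of_int A\<bar> * real_of_int b ^ 2 \<le> \<bar>real_of_int A\<bar> * ?m"
      "\<bar>real_of_int B\<bar> * \<bar>real_of_int a * real_of_int b\<bar> \<le> \<bar>real_of_int B\<bar> * ?m"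
      "\<bar>real_of_int C\<bar> * real_of_int a ^ 2 \<le> \<bar>real_of_int C\<bar> * ?m"
      using sq by (auto intro!: mult_left_mono)
    have "real_of_int q = real_of_int A * real_of_int b ^ 2
        + real_of_int B * - (real_of_int a * real_of_int b) + real_of_int C * real_of_int a ^ 2"
      by (simp add: q_def)
    hence "\<bar>real_of_int q\<bar> \<le> \<bar>real_of_int A * real_of_int b ^ 2\<bar>
        + \<bar>real_of_int B * - (real_of_int a * real_of_int b)\<bar> + \<bar>real_of_int C * real_of_int a ^ 2\<bar>"
      by linarith
    also have "\<dots> \<le> ?S * ?m"
      using bnd by (simp only: abs_mult abs_minus_cancel abs_power2 of_int_add of_int_abs distrib_right)
    finally have "real_of_int \<bar>q\<bar> \<le> ?S * ?m" by simp
    hence "1 / (?S * ?m) \<le> 1 / real_of_int \<bar>q\<bar>"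
      using q0 by (intro divide_left_mono) auto
    also have "\<dots> \<le> padic_abs (of_int q :: 'p padic)" by (rule padic_abs_of_int_ge[OF q0])
    finally show ?thesis using le by simp
  qed
  thus ?thesis using S by (intro that[of "1 / ?S"]) (auto simp: is_PBad_abs_proj_line[OF v])
qed

text \<open>This allows a common \<open>\<epsilon>\<close> for the finitely many points of a
  periodic orbit.\<close>

lemma is_PBad_mono:
  fixes x :: "'p::prime_card padic proj_line"
  assumes "is_PBad \<epsilon> x" "\<epsilon>' \<le> \<epsilon>"
  shows "is_PBad \<epsilon>' x"
  using assms
proof transfer
  fix \<epsilon> \<epsilon>' :: real and q :: "'p padic ^ 2"
  let ?r = "\<lambda>a b :: int. padic_abs (of_int a * q $ 1 + of_int b * q $ 2)
    / max (padic_abs (q $ 1)) (padic_abs (q $ 2))"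
  assume *: "\<forall>a b :: int. (a, b) \<noteq> (0, 0) \<longrightarrow>
      \<epsilon> / max (real_of_int a ^ 2) (real_of_int b ^ 2) \<le> ?r a b" and le: "\<epsilon>' \<le> \<epsilon>"
  have "\<epsilon>' / max (real_of_int a ^ 2) (real_of_int b ^ 2)
      \<le> \<epsilon> / max (real_of_int a ^ 2) (real_of_int b ^ 2)" for a b
    using le by (intro divide_right_mono) (auto simp: le_max_iff_disj)
  thus "\<forall>a b :: int. (a, b) \<noteq> (0, 0) \<longrightarrow>
      \<epsilon>' / max (real_of_int a ^ 2) (real_of_int b ^ 2) \<le> ?r a b"
    using * by (meson order_trans)
qed

section \<open>Orbits of the shift\<close>

text \<open>Each \<open>cf_matrix a\<close> is symmetric, so transposition only reverses the
  product: the first letter of \<open>u\<close> acts first, as under the shift.\<close>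

definition cf_orbit :: "nat list \<Rightarrow> 'a::field ^ 2 \<Rightarrow> 'a ^ 2" where
  "cf_orbit u v = transpose (cf_word_matrix u) *v v"

lemma cf_word_matrix_append: "cf_word_matrix (u @ u') = cf_word_matrix u ** cf_word_matrix u'"
  by (induction u) (simp_all add: cf_word_matrix_def matrix_mul_assoc)

lemma cf_orbit_append: "cf_orbit (u @ u') v = cf_orbit u' (cf_orbit u v)"
  unfolding cf_orbit_def cf_word_matrix_append matrix_transpose_mul matrix_vector_mul_assoc ..

lemma cf_orbit_Nil: "cf_orbit [] v = v"
  by (simp add: cf_orbit_def cf_word_matrix_def transpose_mat)

lemma cf_orbit_single: "cf_orbit [a] v = cf_matrix a *v v"
proof -
  have "transpose (cf_matrix a) = (cf_matrix a :: 'a ^ 2 ^ 2)"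
    by (simp add: cf_matrix_def transpose_def vec_eq_iff forall_2)
  thus ?thesis unfolding cf_orbit_def by (simp add: cf_word_matrix_def)
qed

lemma cf_matrix_mult_vec_component:
  "(cf_matrix a *v v) $ 1 = v $ 2" "(cf_matrix a *v v) $ 2 = v $ 1 + of_nat a * v $ 2"
  by (simp_all add: cf_matrix_mult_vec)

lemma cf_orbit_scale: "cf_orbit u (c *s v) = c *s cf_orbit u v"
  by (simp add: cf_orbit_def vector_scalar_commute del: transpose_matrix_vector)

lemma cf_orbit_nonzero: "v \<noteq> 0 \<Longrightarrow> cf_orbit u v \<noteq> 0"
proof (induction u rule: rev_induct)
  case (snoc a u)
  thus ?case by (auto simp: cf_orbit_append cf_orbit_single vec_eq_iff forall_2 cf_matrix_mult_vec_component)
qed (simp add: cf_orbit_Nil)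

text \<open>Every \<open>cf_matrix a\<close> is integral with integral inverse, hence an isometry
  for the maximum norm. The denominators in \<open>is_PBad\<close> therefore stay constant along an
  orbit.\<close>

lemma padic_max_cf_orbit:
  fixes v :: "'p::prime_card padic ^ 2"
  shows "max (padic_abs (cf_orbit u v $ 1)) (padic_abs (cf_orbit u v $ 2))
    = max (padic_abs (v $ 1)) (padic_abs (v $ 2))"
proof (induction u rule: rev_induct)
  case (snoc a u)
  have "max (padic_abs y) (padic_abs (x + of_nat a * y)) = max (padic_abs x) (padic_abs y)"
    for x y :: "'p padic"
  proof (rule antisym)
    have ay: "padic_abs (of_nat a * y) \<le> padic_abs y"
      using padic_abs_mult_le[OF padic_abs_of_nat_le_1 order_refl] by simp
    show "max (padic_abs y) (padic_abs (x + of_nat a * y)) \<le> max (padic_abs x) (padic_abs y)"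
      using padic_abs_add[of x "of_nat a * y"] ay by linarith
    have "padic_abs x \<le> max (padic_abs (x + of_nat a * y)) (padic_abs (of_nat a * y))"
      using padic_abs_add[of "x + of_nat a * y" "- (of_nat a * y)"] by simp
    thus "max (padic_abs x) (padic_abs y) \<le> max (padic_abs y) (padic_abs (x + of_nat a * y))"
      using ay by linarith
  qed
  thus ?case using snoc by (simp add: cf_orbit_append cf_orbit_single cf_matrix_mult_vec_component)
qed (simp add: cf_orbit_Nil)

text \<open>Appending a letter preserves the signs of the entries and flips the determinant. In
  determinant 1 the product \<open>\<alpha> * \<delta>\<close> is
  \<open>1 + \<beta> * \<gamma>\<close>, hence at least 2, which forces the trace up to 3.\<close>

lemma cf_orbit_components:
  assumes "u \<noteq> []" "set u \<subseteq> {1..}"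
  obtains \<alpha> \<beta> \<gamma> \<delta> :: int where
    "\<forall>v :: 'a::field ^ 2. cf_orbit u v $ 1 = of_int \<alpha> * v $ 1 + of_int \<beta> * v $ 2"
    "\<forall>v :: 'a ^ 2. cf_orbit u v $ 2 = of_int \<gamma> * v $ 1 + of_int \<delta> * v $ 2"
    "\<gamma> \<noteq> 0"
    "\<alpha> * \<delta> - \<beta> * \<gamma> = - 1 \<and> \<alpha> + \<delta> \<ge> 1 \<or> \<alpha> * \<delta> - \<beta> * \<gamma> = 1 \<and> \<alpha> + \<delta> \<ge> 3"
proof -
  have "\<exists>\<alpha> \<beta> \<gamma> \<delta> :: int.
    (\<forall>v :: 'a ^ 2. cf_orbit u v $ 1 = of_int \<alpha> * v $ 1 + of_int \<beta> * v $ 2 \<and>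
      cf_orbit u v $ 2 = of_int \<gamma> * v $ 1 + of_int \<delta> * v $ 2) \<and>
    \<alpha> \<ge> 0 \<and> \<beta> \<ge> 1 \<and> \<gamma> \<ge> 1 \<and> \<delta> \<ge> 1 \<and> (\<alpha> * \<delta> - \<beta> * \<gamma> = 1 \<or> \<alpha> * \<delta> - \<beta> * \<gamma> = - 1)"
    using assms
  proof (induction u rule: rev_nonempty_induct)
    case (single a)
    thus ?case
      by (intro exI[of _ 0] exI[of _ 1] exI[of _ "int a"])
         (auto simp: cf_orbit_single cf_matrix_mult_vec_component)
  next
    case (snoc a u)
    then obtain \<alpha> \<beta> \<gamma> \<delta> :: int where
      IH: "\<And>v :: 'a ^ 2. cf_orbit u v $ 1 = of_int \<alpha> * v $ 1 + of_int \<beta> * v $ 2"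
        "\<And>v :: 'a ^ 2. cf_orbit u v $ 2 = of_int \<gamma> * v $ 1 + of_int \<delta> * v $ 2"
      and pos: "\<alpha> \<ge> 0" "\<beta> \<ge> 1" "\<gamma> \<ge> 1" "\<delta> \<ge> 1"
      and det: "\<alpha> * \<delta> - \<beta> * \<gamma> = 1 \<or> \<alpha> * \<delta> - \<beta> * \<gamma> = - 1"
      by auto
    have a: "int a \<ge> 1" using snoc.prems by simp
    have "int a * \<gamma> \<ge> 1 * 1" "int a * \<delta> \<ge> 1 * 1" using a pos by (intro mult_mono; simp)+
    moreover have "\<gamma> * (\<beta> + int a * \<delta>) - \<delta> * (\<alpha> + int a * \<gamma>) = - (\<alpha> * \<delta> - \<beta> * \<gamma>)"
      by (simp add: algebra_simps)
    ultimately show ?case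
      using IH pos det
      by (intro exI[of _ \<gamma>] exI[of _ \<delta>] exI[of _ "\<alpha> + int a * \<gamma>"] exI[of _ "\<beta> + int a * \<delta>"])
         (auto simp: cf_orbit_append cf_orbit_single cf_matrix_mult_vec_component algebra_simps)
  qed
  then obtain \<alpha> \<beta> \<gamma> \<delta> :: int where
    act: "\<And>v :: 'a ^ 2. cf_orbit u v $ 1 = of_int \<alpha> * v $ 1 + of_int \<beta> * v $ 2"
      "\<And>v :: 'a ^ 2. cf_orbit u v $ 2 = of_int \<gamma> * v $ 1 + of_int \<delta> * v $ 2"
    and pos: "\<alpha> \<ge> 0" "\<beta> \<ge> 1" "\<gamma> \<ge> 1" "\<delta> \<ge> 1"
    and det: "\<alpha> * \<delta> - \<beta> * \<gamma> = 1 \<or> \<alpha> * \<delta> - \<beta> * \<gamma> = - 1"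
    by blast
  have "\<alpha> + \<delta> \<ge> 3" if "\<alpha> * \<delta> - \<beta> * \<gamma> = 1"
  proof (rule ccontr)
    assume "\<not> \<alpha> + \<delta> \<ge> 3"
    hence "\<alpha> = 0 \<or> \<alpha> = 1 \<and> \<delta> = 1" using pos by linarith
    moreover have "\<beta> * \<gamma> \<ge> 1 * 1" using pos by (intro mult_mono) auto
    ultimately show False using that by auto
  qed
  thus ?thesis using act pos det by (intro that[of \<alpha> \<beta> \<gamma> \<delta>]) auto
qed

lemma cf_act_abs_proj_line: "v \<noteq> 0 \<Longrightarrow> cf_act a (abs_proj_line v) = abs_proj_line (cf_matrix a *v v)"
  by (rule cf_act.abs_eq) (auto simp: proj_rel_def intro!: exI[of _ 1])

lemma funpow_shift_pair:
  assumes "v \<noteq> 0"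
  shows "(shift_pair ^^ n) (w, abs_proj_line v) = (sdrop n w, abs_proj_line (cf_orbit (stake n w) v))"
proof (induction n)
  case (Suc n)
  thus ?case
    by (simp add: shift_pair_def stake_Suc cf_orbit_append cf_orbit_single
        cf_act_abs_proj_line cf_orbit_nonzero[OF assms] del: stake.simps)
qed (simp add: cf_orbit_Nil)

lemma abs_proj_line_scale:
  "v \<noteq> 0 \<Longrightarrow> c \<noteq> 0 \<Longrightarrow> abs_proj_line (c *s v) = abs_proj_line v"
  by (rule sym, rule Quotient_rel_abs[OF Quotient_proj_line]) (auto simp: proj_rel_def)

lemma proj_line_normalized_rep:
  fixes x :: "'p::prime_card padic proj_line"
  obtains v where "x = abs_proj_line v" "v \<noteq> 0" "max (padic_abs (v $ 1)) (padic_abs (v $ 2)) = 1"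
proof -
  obtain u where u: "x = abs_proj_line u" "u \<noteq> 0"
    using Quotient_abs_rep[OF Quotient_proj_line, of x] Quotient_rep_reflp[OF Quotient_proj_line, of x]
    by (metis proj_rel_def)
  \<comment> \<open>A coordinate of maximal absolute value, by which the vector is divided.\<close>
  define c where "c = (if padic_abs (u $ 1) \<le> padic_abs (u $ 2) then u $ 2 else u $ 1)"
  have c2: "padic_abs c = max (padic_abs (u $ 1)) (padic_abs (u $ 2))" by (simp add: c_def)
  hence "padic_abs c > 0" using padic_max_pos[OF u(2)] by simp
  hence c: "c \<noteq> 0" by (simp add: padic_abs_pos_iff)
  show ?thesis
  proof (rule that)
    show "x = abs_proj_line (inverse c *s u)" using u c by (simp add: abs_proj_line_scale)
    show "inverse c *s u \<noteq> 0" using u c by (auto simp: vec_eq_iff)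
    have "padic_abs (inverse c) > 0" using c by (simp add: padic_abs_pos_iff)
    hence "max (padic_abs ((inverse c *s u) $ 1)) (padic_abs ((inverse c *s u) $ 2))
        = padic_abs (inverse c) * padic_abs c"
      by (simp add: padic_abs_mult max_mult_distrib_left c2)
    also have "\<dots> = 1" using c by (simp flip: padic_abs_mult)
    finally show "max (padic_abs ((inverse c *s u) $ 1)) (padic_abs ((inverse c *s u) $ 2)) = 1" .
  qed
qed

section \<open>Periodic words and the two implications\<close>

lemma sdrop_period_mult:
  assumes "is_period w l"
  shows "sdrop (n * l) w = w"
proof (induction n)
  case (Suc n)
  have "sdrop (Suc n * l) w = sdrop (n * l) (sdrop l w)" by (simp only: mult_Suc sdrop_add)
  thus ?case using assms Suc by (simp only: is_period_def)
qed simp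

lemma sdrop_streams: "w \<in> streams A \<Longrightarrow> sdrop n w \<in> streams A"
  by (induction n arbitrary: w) (auto intro: streams_stl)

lemma set_stake_subset: "w \<in> streams A \<Longrightarrow> set (stake n w) \<subseteq> A"
  by (induction n arbitrary: w) (auto dest: streams_shd streams_stl)

text \<open>A vector parallel to its image is a zero of the anisotropic form above, so Liouville's
  bound applies.\<close>

lemma eigenvector_is_PBad:
  fixes v :: "'p::prime_card padic ^ 2"
  assumes w: "w \<in> streams {1..}" and l: "l > 0"
    and v: "is_eigenvector (transpose (cf_word_matrix (stake l w))) v"
  obtains \<epsilon> where "\<epsilon> > 0" "is_PBad \<epsilon> (abs_proj_line v)"
proof -
  obtain c where c: "v \<noteq> 0" "cf_orbit (stake l w) v = c *s v"
    using v by (auto simp: is_eigenvector_def cf_orbit_def)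
  have ne: "stake l w \<noteq> []" using l by (cases l) auto
  obtain \<alpha> \<beta> \<gamma> \<delta> :: int where
    act: "\<forall>v :: 'p padic ^ 2. cf_orbit (stake l w) v $ 1 = of_int \<alpha> * v $ 1 + of_int \<beta> * v $ 2"
      "\<forall>v :: 'p padic ^ 2. cf_orbit (stake l w) v $ 2 = of_int \<gamma> * v $ 1 + of_int \<delta> * v $ 2"
    and \<gamma>: "\<gamma> \<noteq> 0"
    and td: "\<alpha> * \<delta> - \<beta> * \<gamma> = - 1 \<and> \<alpha> + \<delta> \<ge> 1 \<or> \<alpha> * \<delta> - \<beta> * \<gamma> = 1 \<and> \<alpha> + \<delta> \<ge> 3"
    by (rule cf_orbit_components[OF ne set_stake_subset[OF w], where 'a="'p padic"])
  have "v $ 1 * (of_int \<gamma> * v $ 1 + of_int \<delta> * v $ 2) = v $ 2 * (of_int \<alpha> * v $ 1 + of_int \<beta> * v $ 2)"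
    unfolding act[rule_format, symmetric] c(2) by simp
  hence "of_int \<gamma> * (v $ 1)\<^sup>2 + of_int (\<delta> - \<alpha>) * v $ 1 * v $ 2 + of_int (- \<beta>) * (v $ 2)\<^sup>2 = 0"
    by (simp add: algebra_simps power2_eq_square)
  from is_PBad_of_isotropic[OF c(1) this fixed_point_form_anisotropic[OF \<gamma> td]] that
  show ?thesis by blast
qed

text \<open>The orbit has period \<open>l\<close>, and its \<open>n\<close>-th point is an
  eigenvector for the word rotated by \<open>n\<close> letters. Only finitely many points occur, and
  one \<open>\<epsilon>\<close> serves them all.\<close>

lemma eigenvector_imp_LMad:
  fixes v :: "'p::prime_card padic ^ 2"
  assumes w: "w \<in> streams {1..N}" and l: "is_period w l"
    and v: "is_eigenvector (transpose (cf_word_matrix (stake l w))) v"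
  shows "(w, abs_proj_line v) \<in> LMad"
proof -
  have v0: "v \<noteq> 0" and l0: "l > 0" using v l by (auto simp: is_eigenvector_def cf_orbit_def is_period_def)
  obtain c where c: "cf_orbit (stake l w) v = c *s v" using v by (auto simp: is_eigenvector_def cf_orbit_def)
  have c0: "c \<noteq> 0" using cf_orbit_nonzero[OF v0, of "stake l w"] c by auto
  let ?x = "\<lambda>n. abs_proj_line (cf_orbit (stake n w) v)"
  have shift: "cf_orbit (stake (l + n) w) v = c *s cf_orbit (stake n w) v" for n
  proof -
    have "stake (l + n) w = stake l w @ stake n w"
      using l by (metis is_period_def stake_add)
    thus ?thesis by (simp add: cf_orbit_append c cf_orbit_scale)
  qed
  have "?x (l + n) = ?x n" for n
    unfolding shift by (intro abs_proj_line_scale cf_orbit_nonzero v0 c0)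
  hence "?x (k * l + n) = ?x n" for k n
    by (induction k) (simp_all add: add.assoc)
  hence period: "?x n = ?x (n mod l)" for n by (metis div_mult_mod_eq)
  have streams1: "sdrop n w \<in> streams {1..}" for n
    using sdrop_streams[OF w, of n] streams_mono2[of "{1..N}" "{1..}"] by auto
  have "\<exists>\<epsilon>>0. is_PBad \<epsilon> (?x n)" for n
  proof -
    have "cf_orbit (stake l (sdrop n w)) (cf_orbit (stake n w) v) = cf_orbit (stake (n + l) w) v"
      by (simp only: stake_add cf_orbit_append[symmetric])
    also have "\<dots> = c *s cf_orbit (stake n w) v" using shift[of n] by (simp only: add.commute)
    finally have "is_eigenvector (transpose (cf_word_matrix (stake l (sdrop n w)))) (cf_orbit (stake n w) v)"
      using cf_orbit_nonzero[OF v0] by (auto simp: is_eigenvector_def cf_orbit_def)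
    from eigenvector_is_PBad[OF streams1 l0 this] show ?thesis by blast
  qed
  hence "\<forall>\<^sub>F \<epsilon> in at_right 0. is_PBad \<epsilon> (?x n)" for n
    unfolding eventually_at_right_field by (meson is_PBad_mono less_imp_le)
  hence "\<forall>\<^sub>F \<epsilon> in at_right 0. \<forall>n\<in>{..<l}. is_PBad \<epsilon> (?x n)"
    by (intro eventually_ball_finite) auto
  \<comment> \<open>So small an \<open>\<epsilon>\<close> makes the alphabet attached to it contain
    all letters up to \<open>N\<close>.\<close>
  moreover have "\<forall>\<^sub>F \<epsilon> in at_right 0. \<epsilon> < 1 / (real N + 1)"
    unfolding eventually_at_right_field by (auto intro!: exI[of _ "1 / (real N + 1)"])
  moreover have "\<forall>\<^sub>F \<epsilon> in at_right 0. \<epsilon> > (0 :: real)" by (simp add: eventually_at_right_less)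
  ultimately have "\<forall>\<^sub>F \<epsilon> in at_right 0. (\<forall>n\<in>{..<l}. is_PBad \<epsilon> (?x n)) \<and> \<epsilon> < 1 / (real N + 1) \<and> \<epsilon> > 0"
    by eventually_elim auto
  then obtain \<epsilon> where \<epsilon>: "\<forall>n\<in>{..<l}. is_PBad \<epsilon> (?x n)" "\<epsilon> < 1 / (real N + 1)" "\<epsilon> > 0"
    using eventually_happens'[OF trivial_limit_at_right_real] by blast
  have "real N \<le> 1 / \<epsilon>" using \<epsilon>(2,3) by (simp add: field_simps)
  hence "N \<le> nat \<lfloor>1 / \<epsilon>\<rfloor> + 1" by linarith
  hence "sdrop n w \<in> streams {1..nat \<lfloor>1 / \<epsilon>\<rfloor> + 1}" for n
    using sdrop_streams[OF w, of n] streams_mono2[of "{1..N}" "{1..nat \<lfloor>1 / \<epsilon>\<rfloor> + 1}"] by auto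
  moreover have "is_PBad \<epsilon> (?x n)" for n
    using \<epsilon>(1) l0 by (subst period) auto
  ultimately have "(w, abs_proj_line v) \<in> LMad_eps \<epsilon>"
    using streams1[of 0] by (auto simp: LMad_eps_def funpow_shift_pair[OF v0] PBad_def)
  thus ?thesis using \<epsilon>(3) by (auto simp: LMad_def)
qed

text \<open>At multiples of \<open>l\<close> the orbit consists of the powers of one integer matrix
  applied to \<open>v\<close>. Were \<open>v\<close> and its image independent, a fixed integer form
  would take arbitrarily small values there, whereas \<open>is_PBad\<close> bounds it below by a
  positive constant.\<close>

lemma LMad_imp_eigenvector:
  fixes x :: "'p::prime_card padic proj_line"
  assumes l: "is_period w l" and x: "(w, x) \<in> LMad"
  shows "\<exists>v. is_eigenvector (transpose (cf_word_matrix (stake l w))) v \<and> x = abs_proj_line v"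
proof -
  obtain v where v: "x = abs_proj_line v" "v \<noteq> 0" "max (padic_abs (v $ 1)) (padic_abs (v $ 2)) = 1"
    by (rule proj_line_normalized_rep)
  obtain \<epsilon> where \<epsilon>: "\<epsilon> > 0" "w \<in> streams {1..}"
      "\<And>n. is_PBad \<epsilon> (abs_proj_line (cf_orbit (stake n w) v))"
    using x unfolding LMad_def LMad_eps_def v(1) by (auto simp: funpow_shift_pair[OF v(2)] PBad_def)
  have ne: "stake l w \<noteq> []" using l by (cases l) (auto simp: is_period_def)
  obtain \<alpha> \<beta> \<gamma> \<delta> :: int where
    act: "\<forall>v :: 'p padic ^ 2. cf_orbit (stake l w) v $ 1 = of_int \<alpha> * v $ 1 + of_int \<beta> * v $ 2"
      "\<forall>v :: 'p padic ^ 2. cf_orbit (stake l w) v $ 2 = of_int \<gamma> * v $ 1 + of_int \<delta> * v $ 2"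
    and "\<gamma> \<noteq> 0" and td: "\<alpha> * \<delta> - \<beta> * \<gamma> = - 1 \<and> \<alpha> + \<delta> \<ge> 1 \<or> \<alpha> * \<delta> - \<beta> * \<gamma> = 1 \<and> \<alpha> + \<delta> \<ge> 3"
    by (rule cf_orbit_components[OF ne set_stake_subset[OF \<epsilon>(2)], where 'a="'p padic"])
  define y where "y n = cf_orbit (stake (n * l) w) v" for n
  have y0: "y 0 = v" by (simp add: y_def cf_orbit_Nil)
  have ySuc: "y (Suc n) = cf_orbit (stake l w) (y n)" for n
  proof -
    have "stake (Suc n * l) w = stake (n * l) w @ stake l (sdrop (n * l) w)"
      by (simp add: add.commute stake_add)
    thus ?thesis by (simp add: y_def cf_orbit_append sdrop_period_mult[OF l])
  qed
  have y1: "y 1 = cf_orbit (stake l w) v" using ySuc[of 0] y0 by simp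
  have dep: "v $ 1 * y 1 $ 2 = v $ 2 * y 1 $ 1"
  proof (rule ccontr)
    assume "v $ 1 * y 1 $ 2 \<noteq> v $ 2 * y 1 $ 1"
    hence "\<exists>a b :: int. (a, b) \<noteq> (0, 0) \<and>
        (\<forall>e>0. \<exists>n. padic_abs (of_int a * y n $ 1 + of_int b * y n $ 2) < e)"
      using td v(3) unfolding y0[symmetric]
      by (intro matrix_orbit_approaches_rational[of y \<alpha> \<beta> \<gamma> \<delta>]) (auto simp: ySuc act)
    then obtain a b :: int where ab: "(a, b) \<noteq> (0, 0)"
      "\<And>e. e > 0 \<Longrightarrow> \<exists>n. padic_abs (of_int a * y n $ 1 + of_int b * y n $ 2) < e"
      by blast
    have "max (real_of_int a ^ 2) (real_of_int b ^ 2) > 0"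
      using ab(1) by (auto simp: less_max_iff_disj)
    hence "\<epsilon> / max (real_of_int a ^ 2) (real_of_int b ^ 2) > 0" using \<epsilon>(1) by simp
    then obtain n where "padic_abs (of_int a * y n $ 1 + of_int b * y n $ 2)
        < \<epsilon> / max (real_of_int a ^ 2) (real_of_int b ^ 2)" using ab(2) by blast
    \<comment> \<open>The denominator in \<open>is_PBad\<close> is 1, because \<open>v\<close> is
      normalised and the orbit maps are isometries.\<close>
    moreover have "padic_abs (of_int a * y n $ 1 + of_int b * y n $ 2)
        \<ge> \<epsilon> / max (real_of_int a ^ 2) (real_of_int b ^ 2)"
      using \<epsilon>(3)[of "n * l"] ab(1) v(3) padic_max_cf_orbit[of "stake (n * l) w" v]
      by (simp add: is_PBad_abs_proj_line cf_orbit_nonzero[OF v(2)] y_def)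
    ultimately show False by simp
  qed
  have "\<exists>c. y 1 = c *s v"
  proof (cases "v $ 1 = 0")
    case True
    hence "v $ 2 \<noteq> 0" using v(2) by (auto simp: vec_eq_iff forall_2)
    thus ?thesis using dep True
      by (intro exI[of _ "y 1 $ 2 / v $ 2"]) (simp add: vec_eq_iff forall_2)
  next
    case False
    thus ?thesis using dep
      by (intro exI[of _ "y 1 $ 1 / v $ 1"]) (simp add: vec_eq_iff forall_2 field_simps)
  qed
  thus ?thesis using v y1 by (auto simp: is_eigenvector_def cf_orbit_def)
qed

theorem theorem1:
  fixes N l :: nat and w :: "nat stream" and x :: "'p::prime_card padic proj_line"
  assumes "w \<in> streams {1..N}"
    and "is_minimal_period w l"
  shows "(w, x) \<in> LMad \<longleftrightarrow>
    (\<exists>v. is_eigenvector (transpose (cf_word_matrix (stake l w))) v \<and> x = abs_proj_line v)"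
proof -
  have l: "is_period w l" using assms(2) by (simp add: is_minimal_period_def)
  show ?thesis using LMad_imp_eigenvector[OF l] eigenvector_imp_LMad[OF assms(1) l] by blast
qed

end
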